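(* Let $f$ be any function with property $P^{\ast}$ and let $n\geq 6$. If $G$ is a bicyclic graph of order $n$ not isomorphic to any of $B_1,B_2,B_3,B_4$, then $\rho(A_f(G))<\rho(A_f(B_3))$.
   Context: All graphs are simple and connected; $d_i$ is the degree of $v_i$. A function $f(x,y)$ (positive, symmetric, twice differentiable in $x$) has property $P^{\ast}$ if $f>0$, $f'_x\geq 0$, $f''_x\geq 0$, and whenever $x_1+y_1=x_2+y_2$ and $|x_1-y_1|>|x_2-y_2|$ we have $f(x_1,y_1)\geq f(x_2,y_2)$. $A_f(G)$ has $(i,j)$-entry $f(d_i,d_j)$ if $v_iv_j\in E(G)$ and $0$ otherwise; $\rho(A_f(G))$ is its largest eigenvalue. A bicyclic graph is a connected graph with $|E|=|V|+1$. The diamond is $K_4$ minus an edge; call its two adjacent degree-3 vertices $u,v$ and its two nonadjacent degree-2 vertices $a,b$. The graphs (all of order $n$): $B_1$ is the diamond with $n-4$ pendant vertices attached to $u$; $B_2$ consists of two triangles sharing exactly one vertex $c$, with $n-5$ pendant vertices attached to $c$; $B_3$ is the diamond with $n-5$ pendant vertices attached to $u$ and one pendant vertex attached to $v$; $B_4$ is the diamond with $n-4$ pendant vertices attached to $a$. *)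

theory Defs
  imports Complex_Main "Jordan_Normal_Form.Char_Poly"
begin

text \<open>Property P* of a function f(x,y): positive, symmetric, twice differentiable in x
  with nonnegative first and second partial derivatives in x, and the majorisation condition.
  Conditions are imposed on the domain x, y > 0 (degrees are positive integers).\<close>
definition property_P_star :: "(real \<Rightarrow> real \<Rightarrow> real) \<Rightarrow> bool" where
  "property_P_star f \<longleftrightarrow>
     (\<forall>x y. x > 0 \<longrightarrow> y > 0 \<longrightarrow> f x y > 0) \<and>
     (\<forall>x y. f x y = f y x) \<and>
     (\<exists>f1 f2 :: real \<Rightarrow> real \<Rightarrow> real.
        (\<forall>x y. x > 0 \<longrightarrow> y > 0 \<longrightarrow>
            ((\<lambda>t. f t y) has_real_derivative f1 x y) (at x) \<and>
            ((\<lambda>t. f1 t y) has_real_derivative f2 x y) (at x) \<and>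
            f1 x y \<ge> 0 \<and> f2 x y \<ge> 0)) \<and>
     (\<forall>x1 y1 x2 y2. x1 > 0 \<longrightarrow> y1 > 0 \<longrightarrow> x2 > 0 \<longrightarrow> y2 > 0 \<longrightarrow>
        x1 + y1 = x2 + y2 \<longrightarrow> \<bar>x1 - y1\<bar> > \<bar>x2 - y2\<bar> \<longrightarrow> f x1 y1 \<ge> f x2 y2)"

definition simple_graph :: "nat \<Rightarrow> nat set set \<Rightarrow> bool" where
  "simple_graph n E \<longleftrightarrow> (\<forall>e\<in>E. \<exists>i j. e = {i, j} \<and> i \<noteq> j \<and> i < n \<and> j < n)"

definition connected_graph :: "nat \<Rightarrow> nat set set \<Rightarrow> bool" where
  "connected_graph n E \<longleftrightarrow>
     (\<forall>i<n. \<forall>j<n. (\<lambda>x y. {x, y} \<in> E)\<^sup>*\<^sup>* i j)"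

definition bicyclic :: "nat \<Rightarrow> nat set set \<Rightarrow> bool" where
  "bicyclic n E \<longleftrightarrow> simple_graph n E \<and> connected_graph n E \<and> card E = n + 1"

definition degree :: "nat set set \<Rightarrow> nat \<Rightarrow> nat" where
  "degree E i = card {j. {i, j} \<in> E}"

definition graph_iso :: "nat \<Rightarrow> nat set set \<Rightarrow> nat set set \<Rightarrow> bool" where
  "graph_iso n E E' \<longleftrightarrow>
     (\<exists>\<pi>. bij_betw \<pi> {..<n} {..<n} \<and>
        (\<forall>i<n. \<forall>j<n. {i, j} \<in> E \<longleftrightarrow> {\<pi> i, \<pi> j} \<in> E'))"

definition A_f :: "(real \<Rightarrow> real \<Rightarrow> real) \<Rightarrow> nat \<Rightarrow> nat set set \<Rightarrow> real mat" where
  "A_f f n E = mat n n (\<lambda>(i, j). if {i, j} \<in> E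
                                    then f (real (degree E i)) (real (degree E j)) else 0)"

definition rho :: "real mat \<Rightarrow> real" where
  "rho A = Max {k. eigenvalue A k}"

definition diamond :: "nat set set" where
  "diamond = {{0, 1}, {0, 2}, {0, 3}, {1, 2}, {1, 3}}"

definition B1 :: "nat \<Rightarrow> nat set set" where
  "B1 n = diamond \<union> {{0, k} | k. 4 \<le> k \<and> k < n}"

definition B2 :: "nat \<Rightarrow> nat set set" where
  "B2 n = {{0, 1}, {0, 2}, {1, 2}, {0, 3}, {0, 4}, {3, 4}} \<union> {{0, k} | k. 5 \<le> k \<and> k < n}"

definition B3 :: "nat \<Rightarrow> nat set set" where
  "B3 n = diamond \<union> {{0, k} | k. 4 \<le> k \<and> k < n - 1} \<union> {{1, n - 1}}"

definition B4 :: "nat \<Rightarrow> nat set set" where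
  "B4 n = diamond \<union> {{2, k} | k. 4 \<le> k \<and> k < n}"

end

theory Submission
  imports Defs "HOL-Analysis.Function_Topology" "HOL-Analysis.Convex"
begin

text \<open>
  Let \<open>x\<close> be a Perron vector of \<open>A\<^sub>f(G)\<close>. Moving to \<open>u\<close> all neighbours of \<open>v\<close> outside \<open>N[u]\<close> (the
  Kelmans transformation) does not decrease the quadratic form of \<open>A\<^sub>f\<close>, evaluated at \<open>x\<close> with its
  entries at \<open>u\<close> and \<open>v\<close> exchanged if necessary, so it increases the spectral radius; here
  property P* is just what is needed. Call a bicyclic graph admissible if it has no vertex
  adjacent to all others and is not \<open>B\<^sub>4\<close>. If no Kelmans transformation of an admissible \<open>G\<close> is
  admissible, then the neighbourhoods of vertices with a common neighbour are mostly nested, and a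
  case analysis around a vertex of maximum degree shows that \<open>G\<close> is a diamond with pendant vertices
  at both vertices of degree 3. Unless \<open>G\<close> is \<open>B\<^sub>3\<close>, moving a single pendant vertex
  between these two increases the spectral radius. So \<open>B\<^sub>3\<close> is the only maximiser among admissible
  graphs.
\<close>

section \<open>The largest eigenvalue of a symmetric matrix\<close>

text \<open>The obstacle is that a Kelmans transformation may end in \<open>B1\<close>,
  \<open>B2\<close> or \<open>B4\<close>, with which \<open>B3\<close> is not compared. Improvements
  must therefore stay among the admissible graphs, and a graph without admissible improvement may
  still have Kelmans transformations: they only lead to a vertex adjacent to all others or to
  \<open>B4\<close>. These targets are so rigid that the graph before the transformation can be read
  off from them. Conversely, two pendant vertices with different neighbours already make a bicyclic
  graph admissible, so many configurations are refuted by a transformation after which two such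
  vertices are visible. The case analysis stays small because |E| = n + 1: the edges avoiding a
  vertex number just two more than its non-neighbours. Strictness needs no estimate of the gain. If
  the spectral radius did not grow, the test vector would be an eigenvector of the new matrix, but
  it violates the eigenvalue equation at \<open>u\<close>.\<close>

definition qform :: "(nat \<Rightarrow> nat \<Rightarrow> real) \<Rightarrow> nat \<Rightarrow> (nat \<Rightarrow> real) \<Rightarrow> real" where
  "qform w n x = (\<Sum>i<n. \<Sum>j<n. w i j * x i * x j)"

definition sqn :: "nat \<Rightarrow> (nat \<Rightarrow> real) \<Rightarrow> real" where
  "sqn n x = (\<Sum>i<n. (x i)\<^sup>2)"

definition wmat :: "(nat \<Rightarrow> nat \<Rightarrow> real) \<Rightarrow> nat \<Rightarrow> real mat" where
  "wmat w n = mat n n (\<lambda>(i, j). w i j)"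

lemma qform_scale: "qform w n (\<lambda>i. c * x i) = c\<^sup>2 * qform w n x"
  by (simp add: qform_def sum_distrib_left power2_eq_square mult.assoc mult.left_commute)

lemma sqn_scale: "sqn n (\<lambda>i. c * x i) = c\<^sup>2 * sqn n x"
  by (simp add: sqn_def sum_distrib_left power_mult_distrib)

lemma sqn_pos_iff: "sqn n x > 0 \<longleftrightarrow> (\<exists>i<n. x i \<noteq> 0)"
proof -
  have "sqn n x = 0 \<longleftrightarrow> (\<forall>i<n. x i = 0)"
    by (auto simp: sqn_def sum_nonneg_eq_0_iff)
  moreover have "sqn n x \<ge> 0" by (simp add: sqn_def sum_nonneg)
  ultimately show ?thesis by (metis less_le)
qed

lemma qform_eigen:
  assumes "\<And>i. i < n \<Longrightarrow> (\<Sum>j<n. w i j * x j) = r * x i"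
  shows "qform w n x = r * sqn n x"
proof -
  have "qform w n x = (\<Sum>i<n. x i * (\<Sum>j<n. w i j * x j))"
    by (simp add: qform_def sum_distrib_left mult_ac)
  also have "\<dots> = r * sqn n x"
    unfolding sqn_def sum_distrib_left[of r]
    by (intro sum.cong refl) (simp add: assms power2_eq_square)
  finally show ?thesis .
qed

lemma qform_perturb:
  assumes sym: "\<And>i j. i < n \<Longrightarrow> j < n \<Longrightarrow> w i j = w j i"
  shows "qform w n (\<lambda>i. x i + t * z i)
     = qform w n x + 2 * t * (\<Sum>i<n. z i * (\<Sum>j<n. w i j * x j)) + t\<^sup>2 * qform w n z"
proof -
  have "(\<Sum>i<n. \<Sum>j<n. w i j * x i * z j) = (\<Sum>j<n. \<Sum>i<n. w i j * x i * z j)"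
    by (rule sum.swap)
  also have "\<dots> = (\<Sum>i<n. \<Sum>j<n. w i j * z i * x j)"
    by (intro sum.cong refl) (simp add: sym mult_ac)
  finally have "(\<Sum>i<n. \<Sum>j<n. w i j * x i * z j) = (\<Sum>i<n. \<Sum>j<n. w i j * z i * x j)" .
  moreover have "qform w n (\<lambda>i. x i + t * z i) = qform w n x
      + t * (\<Sum>i<n. \<Sum>j<n. w i j * x i * z j) + t * (\<Sum>i<n. \<Sum>j<n. w i j * z i * x j)
      + t\<^sup>2 * qform w n z"
    by (simp add: qform_def sum_distrib_left sum.distrib[symmetric] algebra_simps power2_eq_square)
  moreover have "(\<Sum>i<n. z i * (\<Sum>j<n. w i j * x j)) = (\<Sum>i<n. \<Sum>j<n. w i j * z i * x j)"
    by (simp add: sum_distrib_left mult_ac)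
  ultimately show ?thesis by simp
qed

lemma sqn_perturb:
  "sqn n (\<lambda>i. x i + t * z i) = sqn n x + 2 * t * (\<Sum>i<n. z i * x i) + t\<^sup>2 * sqn n z"
  by (simp add: sqn_def sum_distrib_left sum.distrib[symmetric] power2_eq_square algebra_simps)

lemma linear_coeff_zero:
  fixes b c :: real
  assumes "\<And>t. b * t + c * t\<^sup>2 \<le> 0"
  shows "b = 0"
proof (rule ccontr)
  assume b: "b \<noteq> 0"
  \<comment> \<open>Chosen so that b t - |c| t^2 equals t^2 exactly, which is positive.\<close>
  define t where "t = b / (\<bar>c\<bar> + 1)"
  have "b * t + c * t\<^sup>2 \<ge> b * t - \<bar>c\<bar> * t\<^sup>2"
    by (smt (verit) mult_minus_left mult_right_mono zero_le_power2)
  moreover have "b * t - \<bar>c\<bar> * t\<^sup>2 = t\<^sup>2"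
  proof -
    have "b = t * (\<bar>c\<bar> + 1)" by (simp add: t_def)
    then show ?thesis by (simp add: power2_eq_square algebra_simps)
  qed
  moreover have "t\<^sup>2 > 0" using b by (simp add: t_def)
  ultimately show False using assms[of t] by linarith
qed

text \<open>First-order condition at a maximum: along the residual \<open>z\<close> = Ax - rx the
  Rayleigh bound is a quadratic inequality in \<open>t\<close> whose linear coefficient is twice
  \<open>sqn n z\<close>, so the residual vanishes.\<close>

lemma rayleigh_equality:
  assumes sym: "\<And>i j. i < n \<Longrightarrow> j < n \<Longrightarrow> w i j = w j i"
    and bound: "\<And>y. qform w n y \<le> r * sqn n y"
    and eq: "qform w n x = r * sqn n x"
    and i: "i < n"
  shows "(\<Sum>j<n. w i j * x j) = r * x i"
proof -
  define z where "z = (\<lambda>i. (\<Sum>j<n. w i j * x j) - r * x i)"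
  define b where "b = (\<Sum>i<n. z i * (\<Sum>j<n. w i j * x j)) - r * (\<Sum>i<n. z i * x i)"
  have "(2 * b) * t + (qform w n z - r * sqn n z) * t\<^sup>2 \<le> 0" for t
    using bound[of "\<lambda>i. x i + t * z i"] eq
    by (simp add: qform_perturb[OF sym] sqn_perturb b_def algebra_simps)
  then have "2 * b = 0" by (rule linear_coeff_zero)
  moreover have "b = sqn n z"
    by (simp add: b_def z_def sqn_def sum_distrib_left sum_subtractf[symmetric] power2_eq_square
        algebra_simps)
  ultimately have "\<not> sqn n z > 0" by simp
  then have "z i = 0" using i by (auto simp: sqn_pos_iff)
  then show ?thesis by (simp add: z_def)
qed

lemma rayleigh_maximizer:
  assumes n: "n > 0"
  obtains x r where "sqn n x > 0" "qform w n x = r * sqn n x"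
    "\<And>y. qform w n y \<le> r * sqn n y"
proof -
  \<comment> \<open>Vectors are functions on all naturals. Pinning the coordinates from
    \<open>n\<close> on to 0 makes the box a product of compact sets, compact by Tychonoff's
    theorem.\<close>
  define K where "K = PiE UNIV (\<lambda>i. if i < n then {-1..1::real} else {0})"
  have "compactin (product_topology (\<lambda>_. euclidean) UNIV) K"
    unfolding K_def by (simp add: compactin_PiE)
  then have "compact K" by (simp add: euclidean_product_topology)
  have cont: "continuous_on UNIV (\<lambda>x :: nat \<Rightarrow> real. x i)" for i
    by simp
  have "continuous_on UNIV (sqn n)"
    unfolding sqn_def by (intro continuous_intros cont)
  then have "closed {x. sqn n x = 1}"
    by (intro closed_Collect_eq) auto
  then have "compact (K \<inter> {x. sqn n x = 1})" using \<open>compact K\<close> by blast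
  moreover have "(\<lambda>i. if i = 0 then 1 else 0) \<in> K \<inter> {x. sqn n x = 1}"
    using n by (auto simp: K_def sqn_def if_distrib[of "\<lambda>x. x ^ _"] sum.If_cases cong: if_cong)
  moreover have "continuous_on (K \<inter> {x. sqn n x = 1}) (qform w n)"
    unfolding qform_def
    by (intro continuous_intros continuous_on_subset[OF cont]) auto
  ultimately obtain x where x: "x \<in> K" "sqn n x = 1"
    and max: "\<And>y. y \<in> K \<Longrightarrow> sqn n y = 1 \<Longrightarrow> qform w n y \<le> qform w n x"
    using continuous_attains_sup[of "K \<inter> {x. sqn n x = 1}" "qform w n"] by blast
  have "qform w n y \<le> qform w n x * sqn n y" for y
  proof (cases "sqn n y > 0")
    case False
    then have "\<forall>i<n. y i = 0" by (simp add: sqn_pos_iff)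
    then show ?thesis by (simp add: qform_def sqn_def)
  next
    case True
    define c where "c = 1 / sqrt (sqn n y)"
    have c: "c\<^sup>2 = 1 / sqn n y" using True by (simp add: c_def power_divide)
    \<comment> \<open>Clearing the entries from \<open>n\<close> on puts the normalised vector into
      \<open>K\<close>; neither form reads them.\<close>
    define y' where "y' = (\<lambda>i. if i < n then c * y i else 0)"
    have cong: "sqn n y' = sqn n (\<lambda>i. c * y i)" "qform w n y' = qform w n (\<lambda>i. c * y i)"
      by (simp_all add: sqn_def qform_def y'_def)
    have s: "sqn n y' = 1" using True by (simp add: cong sqn_scale c)
    have "y' \<in> K"
    proof -
      have "\<bar>y' i\<bar> \<le> 1" if "i < n" for i
      proof -
        have "(y' i)\<^sup>2 \<le> sqn n y'"
          unfolding sqn_def by (rule member_le_sum) (use that in auto)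
        then show ?thesis using s abs_square_le_1 by fastforce
      qed
      then show ?thesis by (auto simp: K_def abs_le_iff) (auto simp: y'_def)
    qed
    from max[OF this s] show ?thesis using True
      by (simp add: cong qform_scale c field_simps)
  qed
  then show ?thesis using that[of x "qform w n x"] x by simp
qed

section \<open>Matrix eigenvalues as extremal Rayleigh quotients\<close>

lemma wmat_mult_vec:
  "wmat w n *\<^sub>v vec n x = vec n (\<lambda>i. \<Sum>j<n. w i j * x j)"
  by (intro eq_vecI) (auto simp: wmat_def scalar_prod_def lessThan_atLeast0)

lemma eigenvalue_wmat_iff:
  "eigenvalue (wmat w n) k \<longleftrightarrow>
     (\<exists>x. (\<exists>i<n. x i \<noteq> 0) \<and> (\<forall>i<n. (\<Sum>j<n. w i j * x j) = k * x i))"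
proof
  assume "eigenvalue (wmat w n) k"
  then obtain v where v: "v \<in> carrier_vec n" "v \<noteq> 0\<^sub>v n" "wmat w n *\<^sub>v v = k \<cdot>\<^sub>v v"
    by (auto simp: eigenvalue_def eigenvector_def wmat_def)
  have vx: "v = vec n (($) v)" using v(1) by auto
  have e: "vec n (\<lambda>i. \<Sum>j<n. w i j * v $ j) = k \<cdot>\<^sub>v v"
    using v(3) vx wmat_mult_vec[of w n "($) v"] by simp
  have "(\<Sum>j<n. w i j * v $ j) = k * v $ i" if "i < n" for i
    using arg_cong[OF e, of "\<lambda>u. u $ i"] that v(1) by simp
  moreover have "\<exists>i<n. v $ i \<noteq> 0"
    using v(1,2) by (metis carrier_vecD eq_vecI index_zero_vec)
  ultimately show "\<exists>x. (\<exists>i<n. x i \<noteq> 0) \<and> (\<forall>i<n. (\<Sum>j<n. w i j * x j) = k * x i)" by blast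
next
  assume "\<exists>x. (\<exists>i<n. x i \<noteq> 0) \<and> (\<forall>i<n. (\<Sum>j<n. w i j * x j) = k * x i)"
  then obtain x i where x: "i < n" "x i \<noteq> 0" "\<And>i. i < n \<Longrightarrow> (\<Sum>j<n. w i j * x j) = k * x i"
    by blast
  have "vec n x \<noteq> 0\<^sub>v n" using x(1,2) by (metis index_vec index_zero_vec(1))
  moreover have "wmat w n *\<^sub>v vec n x = k \<cdot>\<^sub>v vec n x"
    unfolding wmat_mult_vec by (intro eq_vecI) (auto simp: x(3))
  ultimately show "eigenvalue (wmat w n) k"
    by (auto simp: eigenvalue_def eigenvector_def wmat_def intro!: exI[of _ "vec n x"])
qed

text \<open>Since \<open>rho\<close> is a \<open>Max\<close>, the spectrum has to be shown finite,
  which follows from the characteristic polynomial being nonzero. The Rayleigh bound applied to an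
  eigenvector bounds its eigenvalue.\<close>

lemma rho_wmat_eqI:
  assumes "\<exists>i<n. x i \<noteq> 0" "\<And>i. i < n \<Longrightarrow> (\<Sum>j<n. w i j * x j) = r * x i"
    and bound: "\<And>y. qform w n y \<le> r * sqn n y"
  shows "rho (wmat w n) = r"
  unfolding rho_def
proof (rule Max_eqI)
  have A: "wmat w n \<in> carrier_mat n n" by (simp add: wmat_def)
  then have "char_poly (wmat w n) \<noteq> 0"
    using degree_monic_char_poly[OF A] by auto
  then show "finite {k. eigenvalue (wmat w n) k}"
    unfolding eigenvalue_root_char_poly[OF A] by (rule poly_roots_finite)
  show "r \<in> {k. eigenvalue (wmat w n) k}" using assms(1,2) by (auto simp: eigenvalue_wmat_iff)
next
  fix k assume "k \<in> {k. eigenvalue (wmat w n) k}"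
  then obtain y where y: "\<exists>i<n. y i \<noteq> 0" "\<And>i. i < n \<Longrightarrow> (\<Sum>j<n. w i j * y j) = k * y i"
    by (auto simp: eigenvalue_wmat_iff)
  have "k * sqn n y \<le> r * sqn n y" using bound[of y] qform_eigen[of n w y k] y(2) by simp
  moreover have "sqn n y > 0" using y(1) by (simp add: sqn_pos_iff)
  ultimately show "k \<le> r" by simp
qed

lemma rho_wmat:
  assumes n: "n > 0" and sym: "\<And>i j. i < n \<Longrightarrow> j < n \<Longrightarrow> w i j = w j i"
  shows rho_wmat_bound: "qform w n y \<le> rho (wmat w n) * sqn n y"
    and rho_wmat_attained: "\<exists>x. (\<exists>i<n. x i \<noteq> 0) \<and> qform w n x = rho (wmat w n) * sqn n x"
proof -
  obtain x r where x: "sqn n x > 0" "qform w n x = r * sqn n x"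
    and bound: "\<And>y. qform w n y \<le> r * sqn n y"
    using rayleigh_maximizer[OF n, of w] by blast
  have nz: "\<exists>i<n. x i \<noteq> 0" using x(1) by (simp add: sqn_pos_iff)
  have "rho (wmat w n) = r"
    by (rule rho_wmat_eqI[of n x]) (use rayleigh_equality[OF sym bound x(2)] nz bound in auto)
  then show "qform w n y \<le> rho (wmat w n) * sqn n y"
    and "\<exists>x. (\<exists>i<n. x i \<noteq> 0) \<and> qform w n x = rho (wmat w n) * sqn n x"
    using bound x nz by auto
qed

text \<open>For nonnegative weights, absolute values do not decrease the quadratic form, so a
  maximiser may be taken nonnegative and is still an eigenvector. A zero entry makes a sum of
  nonnegative terms vanish and so spreads to all neighbours; by connectedness it would reach every
  vertex.\<close>

lemma perron_vector:
  assumes n: "n > 0" and sym: "\<And>i j. i < n \<Longrightarrow> j < n \<Longrightarrow> w i j = w j i"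
    and nonneg: "\<And>i j. i < n \<Longrightarrow> j < n \<Longrightarrow> w i j \<ge> 0"
    and conn: "\<And>i j. i < n \<Longrightarrow> j < n \<Longrightarrow> (\<lambda>a b. a < n \<and> b < n \<and> w a b > 0)\<^sup>*\<^sup>* i j"
  obtains x where "\<And>i. i < n \<Longrightarrow> x i > 0"
    "\<And>i. i < n \<Longrightarrow> (\<Sum>j<n. w i j * x j) = rho (wmat w n) * x i"
proof -
  let ?r = "rho (wmat w n)"
  note bound = rho_wmat_bound[of n w, OF n sym]
  obtain x0 i0 where i0: "i0 < n" "x0 i0 \<noteq> 0" and x0: "qform w n x0 = ?r * sqn n x0"
    using rho_wmat_attained[of n w, OF n sym] by blast
  define x where "x = (\<lambda>i. \<bar>x0 i\<bar>)"
  have "qform w n x0 \<le> qform w n x"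
    unfolding qform_def x_def
    by (intro sum_mono) (use nonneg in \<open>auto simp: abs_mult[symmetric] mult.assoc intro!: mult_left_mono\<close>)
  moreover have "sqn n x = sqn n x0" by (simp add: sqn_def x_def)
  ultimately have "qform w n x = ?r * sqn n x"
    using bound[of x] x0 by simp
  then have eig: "(\<Sum>j<n. w i j * x j) = ?r * x i" if "i < n" for i
    using rayleigh_equality[OF sym bound _ that] by blast
  have step: "x b = 0" if "a < n" "b < n" "w a b > 0" "x a = 0" for a b
  proof -
    have "(\<Sum>j<n. w a j * x j) = 0" using eig[OF that(1)] that(4) by simp
    then have "\<forall>j\<in>{..<n}. w a j * x j = 0"
      by (subst (asm) sum_nonneg_eq_0_iff) (use nonneg that in \<open>auto simp: x_def\<close>)
    then have "w a b * x b = 0" using that(2) by blast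
    then show ?thesis using that(3) by simp
  qed
  have "x i > 0" if "i < n" for i
  proof (rule ccontr)
    assume "\<not> x i > 0"
    then have "x i = 0" by (simp add: x_def)
    have "x b = 0" if "(\<lambda>a b. a < n \<and> b < n \<and> w a b > 0)\<^sup>*\<^sup>* i b" for b
      using that by induction (use \<open>x i = 0\<close> step in auto)
    then have "x i0 = 0" using conn[OF \<open>i < n\<close> i0(1)] by blast
    then show False using i0 by (simp add: x_def)
  qed
  then show ?thesis using that eig by blast
qed

section \<open>Comparing matrices that differ in two rows\<close>

lemma sum_lessThan_split_pair:
  fixes g :: "nat \<Rightarrow> 'a :: comm_monoid_add"
  assumes "u < n" "v < n" "u \<noteq> v"
  shows "(\<Sum>i<n. g i) = g u + (g v + (\<Sum>i\<in>{..<n} - {u, v}. g i))"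
proof -
  have "{..<n} - {u} - {v} = {..<n} - {u, v}" by blast
  then show ?thesis
    using assms by (simp add: sum.remove[of "{..<n}" u] sum.remove[of "{..<n} - {u}" v])
qed

lemma qform_split_pair:
  assumes sym: "\<And>i j. i < n \<Longrightarrow> j < n \<Longrightarrow> w i j = w j i"
    and uv: "u < n" "v < n" "u \<noteq> v" and diag: "w u u = 0" "w v v = 0"
  shows "qform w n x = (\<Sum>i\<in>{..<n} - {u, v}. \<Sum>j\<in>{..<n} - {u, v}. w i j * x i * x j)
     + 2 * (\<Sum>j\<in>{..<n} - {u, v}. (w u j * x u + w v j * x v) * x j) + 2 * (w u v * x u * x v)"
proof -
  let ?R = "{..<n} - {u, v}"
  have "(\<Sum>i\<in>?R. w i u * x i * x u + w i v * x i * x v)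
      = (\<Sum>j\<in>?R. (w u j * x u + w v j * x v) * x j)"
    by (intro sum.cong refl) (use sym uv in \<open>simp add: algebra_simps\<close>)
  moreover have "w v u = w u v" using sym uv by blast
  ultimately show ?thesis
    unfolding qform_def
    by (simp add: sum_lessThan_split_pair[OF uv] diag sum.distrib algebra_simps)
qed

text \<open>The test vector for \<open>w'\<close> is the Perron vector \<open>x\<close> of
  \<open>w\<close> with \<open>X\<close> and \<open>Y\<close> at \<open>u\<close> and
  \<open>v\<close>. Its norm is that of \<open>x\<close>, and \<open>rows\<close> and
  \<open>edge\<close> make its form at least as large, so the radius does not drop. In case of
  equality it would be an eigenvector of \<open>w'\<close>, which \<open>strict\<close> excludes at
  row \<open>u\<close>.\<close>

lemma rho_wmat_less:
  assumes sym: "\<And>i j. i < n \<Longrightarrow> j < n \<Longrightarrow> w i j = w j i"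
    and sym': "\<And>i j. i < n \<Longrightarrow> j < n \<Longrightarrow> w' i j = w' j i"
    and uv: "u < n" "v < n" "u \<noteq> v"
    and diag: "w u u = 0" "w v v = 0" "w' u u = 0" "w' v v = 0"
    and off: "\<And>i j. i \<in> {..<n} - {u, v} \<Longrightarrow> j \<in> {..<n} - {u, v} \<Longrightarrow> w' i j = w i j"
    and pos: "\<And>i. i < n \<Longrightarrow> x i > 0"
    and eig: "\<And>i. i < n \<Longrightarrow> (\<Sum>j<n. w i j * x j) = rho (wmat w n) * x i"
    and XY: "X = x u \<and> Y = x v \<or> X = x v \<and> Y = x u"
    and rows: "(\<Sum>j\<in>{..<n} - {u, v}. (w u j * x u + w v j * x v) * x j)
       \<le> (\<Sum>j\<in>{..<n} - {u, v}. (w' u j * X + w' v j * Y) * x j)"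
    and edge: "w u v \<le> w' u v"
    and strict: "rho (wmat w n) * X < w' u v * Y + (\<Sum>j\<in>{..<n} - {u, v}. w' u j * x j)"
  shows "rho (wmat w n) < rho (wmat w' n)"
proof -
  let ?R = "{..<n} - {u, v}"
  define y where "y = x(u := X, v := Y)"
  have y: "y u = X" "y v = Y" "\<And>j. j \<in> ?R \<Longrightarrow> y j = x j"
    using uv by (auto simp: y_def)
  have XYpos: "X > 0" "Y > 0" "X * Y = x u * x v" using XY pos uv by (auto simp: mult.commute)
  have "sqn n y = sqn n x"
    using XY unfolding sqn_def sum_lessThan_split_pair[OF uv] by (auto simp: y)
  moreover have "qform w n x \<le> qform w' n y"
  proof -
    have "(\<Sum>i\<in>?R. \<Sum>j\<in>?R. w' i j * y i * y j) = (\<Sum>i\<in>?R. \<Sum>j\<in>?R. w i j * x i * x j)"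
      by (intro sum.cong refl) (use off y in auto)
    moreover have "(\<Sum>j\<in>?R. (w' u j * y u + w' v j * y v) * y j)
        = (\<Sum>j\<in>?R. (w' u j * X + w' v j * Y) * x j)"
      by (intro sum.cong refl) (use y in auto)
    moreover have "w u v * x u * x v \<le> w' u v * y u * y v"
      using mult_right_mono[OF edge, of "X * Y"] mult_pos_pos[OF XYpos(1,2)] XYpos(3)
      by (simp add: y mult.assoc)
    moreover have "qform w n x = (\<Sum>i\<in>?R. \<Sum>j\<in>?R. w i j * x i * x j)
        + 2 * (\<Sum>j\<in>?R. (w u j * x u + w v j * x v) * x j) + 2 * (w u v * x u * x v)"
      by (rule qform_split_pair[where w = w, OF _ uv diag(1,2)]) (rule sym)
    moreover have "qform w' n y = (\<Sum>i\<in>?R. \<Sum>j\<in>?R. w' i j * y i * y j)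
        + 2 * (\<Sum>j\<in>?R. (w' u j * y u + w' v j * y v) * y j) + 2 * (w' u v * y u * y v)"
      by (rule qform_split_pair[where w = w', OF _ uv diag(3,4)]) (rule sym')
    ultimately show ?thesis using rows by linarith
  qed
  moreover have "qform w n x = rho (wmat w n) * sqn n x" by (rule qform_eigen) (rule eig)
  ultimately have ge: "rho (wmat w n) * sqn n y \<le> qform w' n y" by simp
  note bound = rho_wmat_bound[of n w', OF _ sym']
  have n: "n > 0" using uv by simp
  have "sqn n y > 0" using uv(1) XYpos(1) by (auto simp: sqn_pos_iff y intro!: exI[of _ u])
  moreover have "rho (wmat w n) * sqn n y \<le> rho (wmat w' n) * sqn n y"
    using ge bound[OF n, of y] by linarith
  ultimately have "rho (wmat w n) \<le> rho (wmat w' n)" by simp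
  moreover have "rho (wmat w n) \<noteq> rho (wmat w' n)"
  proof
    assume eq: "rho (wmat w n) = rho (wmat w' n)"
    then have "qform w' n y = rho (wmat w' n) * sqn n y" using ge bound[OF n, of y] by simp
    then have "(\<Sum>j<n. w' u j * y j) = rho (wmat w' n) * y u"
      using rayleigh_equality[OF sym' bound[OF n] _ uv(1)] by blast
    moreover have "(\<Sum>j\<in>?R. w' u j * y j) = (\<Sum>j\<in>?R. w' u j * x j)"
      by (intro sum.cong refl) (use y in auto)
    ultimately show False
      using strict by (simp add: sum_lessThan_split_pair[OF uv] diag y eq)
  qed
  ultimately show ?thesis by simp
qed

text \<open>The test vector gives the larger of the two Perron entries to \<open>u\<close>, so no assumption on
  which of the two entries is larger is needed.\<close>
lemma rho_wmat_less_exchange: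
  assumes sym: "\<And>i j. i < n \<Longrightarrow> j < n \<Longrightarrow> w i j = w j i"
    and sym': "\<And>i j. i < n \<Longrightarrow> j < n \<Longrightarrow> w' i j = w' j i"
    and uv: "u < n" "v < n" "u \<noteq> v"
    and diag: "w u u = 0" "w v v = 0" "w' u u = 0" "w' v v = 0"
    and off: "\<And>i j. i \<in> {..<n} - {u, v} \<Longrightarrow> j \<in> {..<n} - {u, v} \<Longrightarrow> w' i j = w i j"
    and pos: "\<And>i. i < n \<Longrightarrow> x i > 0"
    and eig: "\<And>i. i < n \<Longrightarrow> (\<Sum>j<n. w i j * x j) = rho (wmat w n) * x i"
    and le_u: "\<And>j. j \<in> {..<n} - {u, v} \<Longrightarrow> w u j \<le> w' u j"
    and le_v: "\<And>j. j \<in> {..<n} - {u, v} \<Longrightarrow> w v j \<le> w' u j"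
    and le_sum: "\<And>j. j \<in> {..<n} - {u, v} \<Longrightarrow> w u j + w v j \<le> w' u j + w' v j"
    and edge: "w u v \<le> w' u v"
    and strict_u: "\<exists>j\<in>{..<n} - {u, v}. w u j < w' u j"
    and strict_v: "\<exists>j\<in>{..<n} - {u, v}. w v j < w' u j"
  shows "rho (wmat w n) < rho (wmat w' n)"
proof -
  let ?R = "{..<n} - {u, v}"
  define X where "X = max (x u) (x v)"
  define Y where "Y = min (x u) (x v)"
  have XY: "X = x u \<and> Y = x v \<or> X = x v \<and> Y = x u" by (auto simp: X_def Y_def)
  have Y: "Y > 0" "Y \<le> X" using pos uv by (auto simp: X_def Y_def)
  show ?thesis
  proof (rule rho_wmat_less[where x = x and X = X and Y = Y, OF _ _ uv diag off pos eig XY _ edge])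
    show "(\<Sum>j\<in>?R. (w u j * x u + w v j * x v) * x j) \<le> (\<Sum>j\<in>?R. (w' u j * X + w' v j * Y) * x j)"
    proof (intro sum_mono mult_right_mono)
      fix j assume j: "j \<in> ?R"
      \<comment> \<open>One copy of both entries is split off at the common height \<open>Y\<close>.
        Only the excess \<open>X - Y\<close> remains, and it multiplies row \<open>u\<close> or row
        \<open>v\<close> of \<open>w\<close>, each bounded by row \<open>u\<close> of
        \<open>w'\<close>.\<close>
      have "w u j * x u + w v j * x v \<le> (w u j + w v j) * Y + w' u j * (X - Y)"
        using XY mult_right_mono[OF le_u[OF j], of "X - Y"] mult_right_mono[OF le_v[OF j], of "X - Y"] Y
        by (auto simp: algebra_simps)
      also have "\<dots> \<le> (w' u j + w' v j) * Y + w' u j * (X - Y)"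
        using mult_right_mono[OF le_sum[OF j], of Y] Y by simp
      finally show "w u j * x u + w v j * x v \<le> w' u j * X + w' v j * Y"
        by (simp add: algebra_simps)
      show "0 \<le> x j" using pos[of j] j by simp
    qed
    show "rho (wmat w n) * X < w' u v * Y + (\<Sum>j\<in>?R. w' u j * x j)"
    proof -
      \<comment> \<open>The eigenvalue equation is used at whichever of \<open>u\<close>,
        \<open>v\<close> carries the larger entry \<open>X\<close>; hence the comparison with row
        \<open>u\<close> of \<open>w'\<close> is prepared for both rows.\<close>
      have lt: "(\<Sum>j\<in>?R. w i j * x j) < (\<Sum>j\<in>?R. w' u j * x j)"
        if "\<And>j. j \<in> ?R \<Longrightarrow> w i j \<le> w' u j" "\<exists>j\<in>?R. w i j < w' u j" for i
        using that by (intro sum_strict_mono_ex1)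
          (auto intro!: mult_right_mono mult_strict_right_mono pos less_imp_le[OF pos])
      have "(\<Sum>j<n. w u j * x j) = w u v * x v + (\<Sum>j\<in>?R. w u j * x j)"
        "(\<Sum>j<n. w v j * x j) = w u v * x u + (\<Sum>j\<in>?R. w v j * x j)"
        by (simp_all add: sum_lessThan_split_pair[OF uv] diag sym[OF uv(1,2)])
      then have "rho (wmat w n) * x u < w u v * x v + (\<Sum>j\<in>?R. w' u j * x j)"
        "rho (wmat w n) * x v < w u v * x u + (\<Sum>j\<in>?R. w' u j * x j)"
        using eig[OF uv(1)] eig[OF uv(2)] lt[OF le_u strict_u] lt[OF le_v strict_v] by linarith+
      moreover have "w u v * Y \<le> w' u v * Y" using edge Y by simp
      ultimately show ?thesis using XY by auto
    qed
  qed (use sym sym' in blast)+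
qed

section \<open>Property P*\<close>

text \<open>Convexity and majorisation are both phrased for a pair \<open>d\<close>,
  \<open>c\<close> with the same sum as \<open>p\<close>, \<open>q\<close> but further apart. This
  fits the degrees of two vertices after and before edges are moved between them.\<close>

lemma property_P_starD:
  assumes f: "property_P_star f"
  shows P_star_pos: "\<lbrakk>x > 0; y > 0\<rbrakk> \<Longrightarrow> f x y > 0"
    and P_star_sym: "f x y = f y x"
    and P_star_mono: "\<lbrakk>0 < x; x \<le> x'; 0 < y\<rbrakk> \<Longrightarrow> f x y \<le> f x' y"
    and P_star_convex: "\<lbrakk>0 < c; c \<le> p; c \<le> q; p + q = d + c; 0 < y\<rbrakk> \<Longrightarrow> f p y + f q y \<le> f d y + f c y"
    and P_star_major: "\<lbrakk>0 < c; c \<le> p; c \<le> q; p + q = d + c\<rbrakk> \<Longrightarrow> f p q \<le> f d c"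
proof -
  note f' = f[unfolded property_P_star_def]
  obtain f1 f2 :: "real \<Rightarrow> real \<Rightarrow> real" where "\<forall>x y. x > 0 \<longrightarrow> y > 0 \<longrightarrow>
      ((\<lambda>t. f t y) has_real_derivative f1 x y) (at x) \<and>
      ((\<lambda>t. f1 t y) has_real_derivative f2 x y) (at x) \<and> f1 x y \<ge> 0 \<and> f2 x y \<ge> 0"
    using f'[THEN conjunct2, THEN conjunct2, THEN conjunct1] by (elim exE)
  note D = this[rule_format]
  note d1 = D[THEN conjunct1] and d2 = D[THEN conjunct2, THEN conjunct1]
    and nn = D[THEN conjunct2, THEN conjunct2, THEN conjunct1]
      D[THEN conjunct2, THEN conjunct2, THEN conjunct2]
  note major = f'[THEN conjunct2, THEN conjunct2, THEN conjunct2, rule_format]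
  note sym = f'[THEN conjunct2, THEN conjunct1, rule_format]
  show "\<lbrakk>x > 0; y > 0\<rbrakk> \<Longrightarrow> f x y > 0" by (rule f'[THEN conjunct1, rule_format])
  show "f x y = f y x" by (rule sym)
  show "f x y \<le> f x' y" if "0 < x" "x \<le> x'" "0 < y"
  proof (rule DERIV_nonneg_imp_nondecreasing[OF that(2)])
    fix t assume "x \<le> t"
    then have "t > 0" using that by simp
    then show "\<exists>l. ((\<lambda>t. f t y) has_real_derivative l) (at t) \<and> 0 \<le> l"
      using d1 nn(1) that(3) by blast
  qed
  show "f p y + f q y \<le> f d y + f c y" if h: "0 < c" "c \<le> p" "c \<le> q" "p + q = d + c" "0 < y"
  proof (cases "d = c")
    case True
    then have "p = c" "q = c" using h by auto
    then show ?thesis using True by simp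
  next
    case False
    have cv: "convex_on {0<..} (\<lambda>t. f t y)"
    proof (rule f''_ge0_imp_convex)
      fix t :: real assume "t \<in> {0<..}"
      then have t: "t > 0" by simp
      show "((\<lambda>t. f t y) has_real_derivative f1 t y) (at t)" by (rule d1[OF t h(5)])
      show "((\<lambda>t. f1 t y) has_real_derivative f2 t y) (at t)" by (rule d2[OF t h(5)])
      show "f2 t y \<ge> 0" by (rule nn(2)[OF t h(5)])
    qed simp
    \<comment> \<open>\<open>p\<close> and \<open>q\<close> lie symmetrically in the interval from
      \<open>c\<close> to \<open>d\<close>, with convex coordinates \<open>t\<close> and
      \<open>1 - t\<close>, so the two convexity inequalities add up.\<close>
    define t where "t = (p - c) / (d - c)"
    have cd: "c < d" using h False by linarith
    have t: "0 \<le> t" "t \<le> 1" using h cd by (auto simp: t_def)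
    have td: "t * (d - c) = p - c" using cd by (simp add: t_def)
    have "p = (1 - t) *\<^sub>R c + t *\<^sub>R d" "q = (1 - (1 - t)) *\<^sub>R c + (1 - t) *\<^sub>R d"
      using td h(4) by (simp_all add: algebra_simps)
    then have "f p y \<le> (1 - t) * f c y + t * f d y"
      "f q y \<le> (1 - (1 - t)) * f c y + (1 - t) * f d y"
      using convex_onD[OF cv, of t c d] convex_onD[OF cv, of "1 - t" c d] t h cd by auto
    then show ?thesis by (simp add: algebra_simps)
  qed
  show "f p q \<le> f d c" if h: "0 < c" "c \<le> p" "c \<le> q" "p + q = d + c"
  \<comment> \<open>Property P* compares only pairs with strictly larger difference. If
    \<open>c\<close> is \<open>p\<close> or \<open>q\<close>, the pairs agree up to order and
    symmetry settles the claim.\<close>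
  proof (cases "c = p \<or> c = q")
    case True
    then have "p = d \<and> q = c \<or> p = c \<and> q = d" using h by auto
    then show ?thesis using sym by auto
  next
    case False
    then show ?thesis using h by (intro major) auto
  qed
qed

section \<open>Neighbourhoods\<close>

definition nbhd :: "nat set set \<Rightarrow> nat \<Rightarrow> nat set" where
  "nbhd E i = {j. {i, j} \<in> E}"

lemma degree_nbhd: "degree E i = card (nbhd E i)"
  by (simp add: degree_def nbhd_def)

lemma mem_nbhd_iff: "j \<in> nbhd E i \<longleftrightarrow> {i, j} \<in> E"
  by (simp add: nbhd_def)

lemma nbhd_sym: "j \<in> nbhd E i \<longleftrightarrow> i \<in> nbhd E j"
  by (simp add: nbhd_def insert_commute)

lemma simple_edgeD: "simple_graph n E \<Longrightarrow> {i, j} \<in> E \<Longrightarrow> i < n \<and> j < n \<and> i \<noteq> j"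
  unfolding simple_graph_def by (metis doubleton_eq_iff)

lemma nbhdD: "simple_graph n E \<Longrightarrow> j \<in> nbhd E i \<Longrightarrow> i < n \<and> j < n \<and> i \<noteq> j"
  by (simp add: nbhd_def simple_edgeD)

lemma finite_nbhd: "simple_graph n E \<Longrightarrow> finite (nbhd E i)"
  by (rule finite_subset[of _ "{..<n}"]) (auto dest: nbhdD)

lemma simple_subset_Pow: "simple_graph n E \<Longrightarrow> E \<subseteq> Pow {..<n}"
  unfolding simple_graph_def by fastforce

lemma finite_simple_graph: "simple_graph n E \<Longrightarrow> finite E"
  by (rule finite_subset[OF simple_subset_Pow]) auto

lemma bicyclicD:
  assumes "bicyclic n E"
  shows "simple_graph n E" "connected_graph n E" "card E = n + 1"
  using assms by (auto simp: bicyclic_def)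

lemma connected_closed_set:
  assumes "connected_graph n E" "u < n" "i < n" "u \<in> C"
    and "\<And>a b. a \<in> C \<Longrightarrow> b \<in> nbhd E a \<Longrightarrow> b \<in> C"
  shows "i \<in> C"
proof -
  have "(\<lambda>x y. {x, y} \<in> E)\<^sup>*\<^sup>* u i" using assms by (auto simp: connected_graph_def)
  then show ?thesis
  proof induction
    case (step y z)
    then show ?case using assms(5)[of y z] by (simp add: nbhd_def)
  qed (rule assms(4))
qed

lemma connected_nbhd_nonempty:
  assumes "connected_graph n E" "n \<ge> 2" "i < n"
  shows "nbhd E i \<noteq> {}"
proof
  assume e: "nbhd E i = {}"
  define j :: nat where "j = (if i = 0 then 1 else 0)"
  have "j < n" "j \<noteq> i" using assms(2) by (auto simp: j_def)
  have "j \<in> {i}" by (rule connected_closed_set[OF assms(1,3) \<open>j < n\<close>]) (use e in auto)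
  then show False using \<open>j \<noteq> i\<close> by simp
qed

text \<open>If \<open>u\<close> has large degree, few edges of a bicyclic graph remain here, and
  together with \<open>nbhd E u\<close> they determine the whole graph.\<close>

definition edges_avoiding :: "nat set set \<Rightarrow> nat \<Rightarrow> nat set set" where
  "edges_avoiding E u = {e \<in> E. u \<notin> e}"

lemma card_edges_avoiding:
  assumes s: "simple_graph n E"
  shows "card E = degree E u + card (edges_avoiding E u)"
proof -
  have "E = (\<lambda>j. {u, j}) ` nbhd E u \<union> edges_avoiding E u"
  proof -
    have "e \<in> (\<lambda>j. {u, j}) ` nbhd E u" if e: "e \<in> E" "u \<in> e" for e
    proof -
      obtain i j where "e = {i, j}" using s e(1) unfolding simple_graph_def by blast
      then have "e = {u, if u = i then j else i}" using e(2) by auto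
      then show ?thesis using e(1) by (metis (no_types) image_eqI mem_nbhd_iff)
    qed
    then show ?thesis by (auto simp: edges_avoiding_def nbhd_def)
  qed
  moreover have "card ((\<lambda>j. {u, j}) ` nbhd E u \<union> edges_avoiding E u)
      = card ((\<lambda>j. {u, j}) ` nbhd E u) + card (edges_avoiding E u)"
    using finite_simple_graph[OF s] finite_nbhd[OF s]
    by (intro card_Un_disjoint) (auto simp: edges_avoiding_def)
  moreover have "card ((\<lambda>j. {u, j}) ` nbhd E u) = degree E u"
    unfolding degree_nbhd by (rule card_image) (auto simp: inj_on_def doubleton_eq_iff)
  ultimately show ?thesis by simp
qed

section \<open>Moving edges\<close>

definition move_edges :: "nat set set \<Rightarrow> nat \<Rightarrow> nat \<Rightarrow> nat set \<Rightarrow> nat set set" where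
  "move_edges E u v P = (E - (\<lambda>w. {v, w}) ` P) \<union> (\<lambda>w. {u, w}) ` P"

text \<open>Moved endpoints lie outside the closed neighbourhood of \<open>u\<close>, so no loop or
  double edge arises and the number of edges is kept; \<open>near\<close> keeps the graph connected.
  An arbitrary \<open>P\<close> covers both the Kelmans transformation and the transfer of one
  pendant vertex.\<close>

locale edge_move =
  fixes n :: nat and E :: "nat set set" and u v :: nat and P :: "nat set"
  assumes bic: "bicyclic n E" and uv: "u < n" "v < n" "u \<noteq> v"
    and P: "P \<subseteq> nbhd E v - insert u (nbhd E u)"
    and near: "v \<in> nbhd E u \<or> nbhd E u \<inter> nbhd E v \<noteq> {}"
begin

abbreviation E' where "E' \<equiv> move_edges E u v P"

lemma simple: "simple_graph n E" and conn: "connected_graph n E"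
  using bic by (auto simp: bicyclic_def)

lemma P_facts: "w \<in> P \<Longrightarrow> w < n \<and> w \<noteq> u \<and> w \<noteq> v \<and> w \<in> nbhd E v \<and> w \<notin> nbhd E u"
  using P nbhdD[OF simple] by fastforce

lemma finite_P: "finite P"
  using P finite_nbhd[OF simple] by (meson finite_Diff finite_subset)

lemma edge'_iff: "{i, j} \<in> E' \<longleftrightarrow>
   {i, j} \<in> E \<and> \<not> (i = v \<and> j \<in> P) \<and> \<not> (j = v \<and> i \<in> P) \<or> i = u \<and> j \<in> P \<or> j = u \<and> i \<in> P"
  unfolding move_edges_def using uv P_facts by (auto simp: doubleton_eq_iff image_iff)

lemma nbhd'_u: "nbhd E' u = nbhd E u \<union> P"
  unfolding nbhd_def edge'_iff using uv P_facts by auto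

lemma nbhd'_v: "nbhd E' v = nbhd E v - P"
  unfolding nbhd_def edge'_iff using uv P_facts by auto

lemma nbhd'_moved: "w \<in> P \<Longrightarrow> nbhd E' w = insert u (nbhd E w - {v})"
  unfolding nbhd_def edge'_iff using uv P_facts[of w] by (auto simp: nbhd_def)

lemma nbhd'_other: "w \<noteq> u \<Longrightarrow> w \<noteq> v \<Longrightarrow> w \<notin> P \<Longrightarrow> nbhd E' w = nbhd E w"
  unfolding nbhd_def edge'_iff by auto

lemma degree'_u: "degree E' u = degree E u + card P"
  unfolding degree_nbhd nbhd'_u
  by (intro card_Un_disjoint finite_nbhd[OF simple] finite_P) (use P_facts in auto)

lemma degree'_v: "degree E' v + card P = degree E v"
proof -
  have "P \<subseteq> nbhd E v" using P by blast
  then show ?thesis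
    unfolding degree_nbhd nbhd'_v using finite_P card_mono[OF finite_nbhd[OF simple]]
    by (simp add: card_Diff_subset)
qed

text \<open>A moved vertex merely exchanges its neighbour \<open>v\<close> for \<open>u\<close>.
  Hence only the rows and columns of \<open>u\<close> and \<open>v\<close> of the weighted matrix
  change.\<close>

lemma degree'_other: "w \<noteq> u \<Longrightarrow> w \<noteq> v \<Longrightarrow> degree E' w = degree E w"
proof (cases "w \<in> P")
  case True
  then have "v \<in> nbhd E w" "u \<notin> nbhd E w" using P_facts nbhd_sym by blast+
  moreover from this have "card (nbhd E w) > 0" using finite_nbhd[OF simple] card_gt_0_iff by blast
  ultimately show ?thesis
    using finite_nbhd[OF simple, of w]
    by (simp add: degree_nbhd nbhd'_moved[OF True])
qed (simp add: degree_nbhd nbhd'_other)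

lemma bicyclic': "bicyclic n E'"
proof -
  have "simple_graph n E'"
    unfolding simple_graph_def
  proof
    fix e assume "e \<in> E'"
    then consider "e \<in> E" | w where "w \<in> P" "e = {u, w}" unfolding move_edges_def by blast
    then show "\<exists>i j. e = {i, j} \<and> i \<noteq> j \<and> i < n \<and> j < n"
    proof cases
      case 1
      then show ?thesis using simple by (simp add: simple_graph_def)
    next
      case 2
      then show ?thesis using uv(1) P_facts by metis
    qed
  qed
  moreover have "connected_graph n E'"
  proof -
    let ?R = "\<lambda>x y. {x, y} \<in> E'"
    have "symp ?R" by (rule sympI) (simp only: insert_commute)
    note symR = sympD[OF symp_rtranclp[OF this]]
    have "?R\<^sup>*\<^sup>* v u"
    \<comment> \<open>Neither the edge \<open>uv\<close> nor an edge to a common neighbour is moved,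
      so \<open>near\<close> still links \<open>v\<close> to \<open>u\<close>. Every lost edge
      \<open>vw\<close> is then replaced by a walk through \<open>u\<close>.\<close>
    proof (cases "v \<in> nbhd E u")
      case True
      then have "{v, u} \<in> E" by (simp add: mem_nbhd_iff insert_commute)
      then have "?R v u" using uv P_facts by (auto simp: edge'_iff)
      then show ?thesis by blast
    next
      case False
      then obtain c where c: "c \<in> nbhd E u" "c \<in> nbhd E v" using near by blast
      then have "{v, c} \<in> E" "{c, u} \<in> E" "c \<notin> P" "c \<noteq> v"
        using P_facts nbhdD[OF simple c(2)] by (auto simp: mem_nbhd_iff insert_commute)
      then have "?R v c" "?R c u" using uv P_facts by (auto simp: edge'_iff)
      then show ?thesis by (meson converse_rtranclp_into_rtranclp rtranclp.rtrancl_refl)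
    qed
    moreover have "?R u w" if "w \<in> P" for w using that by (simp add: edge'_iff)
    ultimately have vw: "?R\<^sup>*\<^sup>* v w" if "w \<in> P" for w using that by (meson rtranclp.rtrancl_into_rtrancl)
    have step: "?R\<^sup>*\<^sup>* a b" if "{a, b} \<in> E" for a b
      using that vw symR[OF vw] by (cases "?R a b") (auto simp: edge'_iff)
    have "?R\<^sup>*\<^sup>* a b" if "(\<lambda>x y. {x, y} \<in> E)\<^sup>*\<^sup>* a b" for a b
      using that by induction (use step in \<open>auto intro: rtranclp_trans\<close>)
    then show ?thesis using conn unfolding connected_graph_def by blast
  qed
  moreover have "card E' = card E"
  proof -
    have sub: "(\<lambda>w. {v, w}) ` P \<subseteq> E" using P_facts by (auto simp: nbhd_def)
    have disj: "(E - (\<lambda>w. {v, w}) ` P) \<inter> (\<lambda>w. {u, w}) ` P = {}" using P_facts by (auto simp: nbhd_def)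
    have ci: "card ((\<lambda>w. {z, w}) ` P) = card P" for z
      by (rule card_image) (auto simp: inj_on_def doubleton_eq_iff)
    have fE: "finite E" by (rule finite_simple_graph[OF simple])
    have "card E' = card (E - (\<lambda>w. {v, w}) ` P) + card P"
      unfolding move_edges_def using card_Un_disjoint[OF _ _ disj] fE finite_P ci by simp
    also have "card (E - (\<lambda>w. {v, w}) ` P) = card E - card P"
      using card_Diff_subset[OF _ sub] finite_P ci by simp
    finally show ?thesis using card_mono[OF fE sub] ci by simp
  qed
  ultimately show ?thesis using bic by (simp add: bicyclic_def)
qed

end

section \<open>Weighted adjacency\<close>

definition edge_weight :: "(real \<Rightarrow> real \<Rightarrow> real) \<Rightarrow> nat set set \<Rightarrow> nat \<Rightarrow> nat \<Rightarrow> real" where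
  "edge_weight f E i j = (if j \<in> nbhd E i then f (real (degree E i)) (real (degree E j)) else 0)"

lemma A_f_wmat: "A_f f n E = wmat (edge_weight f E) n"
  unfolding A_f_def wmat_def edge_weight_def mem_nbhd_iff ..

lemma edge_weight_sym:
  "property_P_star f \<Longrightarrow> edge_weight f E i j = edge_weight f E j i"
  unfolding edge_weight_def using nbhd_sym[of j E i] P_star_sym by metis

lemma degree_pos: "simple_graph n E \<Longrightarrow> j \<in> nbhd E i \<Longrightarrow> degree E i > 0 \<and> degree E j > 0"
  unfolding degree_nbhd card_gt_0_iff using finite_nbhd nbhd_sym by blast

lemma edge_weight_pos:
  "property_P_star f \<Longrightarrow> simple_graph n E \<Longrightarrow> j \<in> nbhd E i \<Longrightarrow> edge_weight f E i j > 0"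
  by (simp add: edge_weight_def P_star_pos degree_pos)

lemma edge_weight_diag: "simple_graph n E \<Longrightarrow> edge_weight f E i i = 0"
  unfolding edge_weight_def using nbhdD by (metis (full_types))

lemma sum_edge_weight:
  assumes "simple_graph n E"
  shows "(\<Sum>j<n. edge_weight f E i j * x j)
    = (\<Sum>j\<in>nbhd E i. f (real (degree E i)) (real (degree E j)) * x j)"
  by (intro sum.mono_neutral_cong_right) (auto simp: edge_weight_def dest: nbhdD[OF assms])

lemma perron_graph:
  assumes f: "property_P_star f" and s: "simple_graph n E" and c: "connected_graph n E" and n: "n > 0"
  obtains x where "\<And>i. i < n \<Longrightarrow> x i > 0"
    "\<And>i. i < n \<Longrightarrow> (\<Sum>j<n. edge_weight f E i j * x j) = rho (A_f f n E) * x i"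
proof -
  note result = that
  have nn: "edge_weight f E i j \<ge> 0" for i j
    using edge_weight_pos[OF f s, of j i] by (cases "j \<in> nbhd E i") (auto simp: edge_weight_def)
  have conn: "(\<lambda>a b. a < n \<and> b < n \<and> edge_weight f E a b > 0)\<^sup>*\<^sup>* i j" if "i < n" "j < n" for i j
  proof -
    have "(\<lambda>x y. {x, y} \<in> E)\<^sup>*\<^sup>* i j" using c that by (auto simp: connected_graph_def)
    then show ?thesis
      by (rule rtranclp_mono[THEN predicate2D, rotated])
        (use edge_weight_pos[OF f s] nbhdD[OF s] in \<open>auto simp: mem_nbhd_iff\<close>)
  qed
  show ?thesis
  proof (rule perron_vector[of n "edge_weight f E"])
    show "edge_weight f E i j = edge_weight f E j i" for i j by (rule edge_weight_sym[OF f])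
    show thesis if "\<And>i. i < n \<Longrightarrow> 0 < x i"
      "\<And>i. i < n \<Longrightarrow> (\<Sum>j<n. edge_weight f E i j * x j) = rho (wmat (edge_weight f E) n) * x i" for x
      using result[of x] that by (simp add: A_f_wmat)
  qed (use n nn conn in auto)
qed

section \<open>The Kelmans transformation and its effect on the spectral radius\<close>

definition kelmans :: "nat set set \<Rightarrow> nat \<Rightarrow> nat \<Rightarrow> nat set set" where
  "kelmans E u v = move_edges E u v (nbhd E v - insert u (nbhd E u))"

text \<open>The last two conditions demand a private neighbour on both sides. Without one at
  \<open>v\<close> nothing would move, and without one at \<open>u\<close> the result would be the
  old graph with \<open>u\<close> and \<open>v\<close> exchanged; neither can increase the
  radius.\<close>

definition compressible :: "nat set set \<Rightarrow> nat \<Rightarrow> nat \<Rightarrow> bool" where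
  "compressible E u v \<longleftrightarrow> u \<noteq> v \<and> (v \<in> nbhd E u \<or> nbhd E u \<inter> nbhd E v \<noteq> {})
     \<and> \<not> nbhd E u \<subseteq> insert v (nbhd E v) \<and> \<not> nbhd E v \<subseteq> insert u (nbhd E u)"

lemma compressible_less:
  "simple_graph n E \<Longrightarrow> compressible E u v \<Longrightarrow> u < n \<and> v < n"
  unfolding compressible_def using nbhdD by fastforce

lemma compressible_edge_move:
  assumes "bicyclic n E" "compressible E u v"
  shows "edge_move n E u v (nbhd E v - insert u (nbhd E u))"
  using assms compressible_less[OF bicyclicD(1)[OF assms(1)] assms(2)]
  unfolding edge_move_def compressible_def by blast

text \<open>Monotonicity of \<open>f\<close> controls the moved edges, convexity the edges to common neighbours and
  the majorisation condition the edge \<open>uv\<close>.\<close>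
lemma kelmans_rho_less:
  assumes f: "property_P_star f" and bic: "bicyclic n E" and comp: "compressible E u v"
  shows "rho (A_f f n E) < rho (A_f f n (kelmans E u v))"
proof -
  define P where "P = nbhd E v - insert u (nbhd E u)"
  interpret edge_move n E u v P
    unfolding P_def by (rule compressible_edge_move[OF bic comp])
  have K: "kelmans E u v = E'" by (simp add: kelmans_def P_def)
  have s': "simple_graph n E'" using bicyclic' by (simp add: bicyclic_def)
  obtain x where x: "\<And>i. i < n \<Longrightarrow> x i > 0"
    "\<And>i. i < n \<Longrightarrow> (\<Sum>j<n. edge_weight f E i j * x j) = rho (A_f f n E) * x i"
    using perron_graph[OF f simple conn] uv by (metis gr_zeroI not_less_zero)
  have nbhd'_u: "nbhd E' u = nbhd E u \<union> (nbhd E v - {u})"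
    by (subst nbhd'_u) (auto simp: P_def)
  have nbhd'_v: "nbhd E' v = nbhd E v \<inter> insert u (nbhd E u)"
    by (subst nbhd'_v) (auto simp: P_def)
  let ?R = "{..<n} - {u, v}"
  let ?w = "edge_weight f E" and ?w' = "edge_weight f E'"
  define c d p q where "c = real (degree E' v)" and "d = real (degree E' u)"
    and "p = real (degree E u)" and "q = real (degree E v)"
  have "nbhd E' v = (if v \<in> nbhd E u then insert u (nbhd E u \<inter> nbhd E v) else nbhd E u \<inter> nbhd E v)"
    using nbhd_sym[of u E v] uv by (auto simp: nbhd'_v)
  \<comment> \<open>When \<open>u\<close> and \<open>v\<close> are adjacent, the surviving neighbour
    \<open>u\<close> of \<open>v\<close> is balanced by the neighbour \<open>v\<close> of
    \<open>u\<close>, which is not a common neighbour. This yields \<open>c\<close> at most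
    \<open>p\<close> below.\<close>
  moreover have "card (insert u (nbhd E u \<inter> nbhd E v)) \<le> degree E u" if "v \<in> nbhd E u"
  proof -
    have sub: "nbhd E u \<inter> nbhd E v \<subseteq> nbhd E u - {v}" using nbhdD[OF simple] by blast
    then have "card (nbhd E u \<inter> nbhd E v) \<le> degree E u - 1"
      using card_mono[OF finite_Diff[OF finite_nbhd[OF simple]] sub] finite_nbhd[OF simple] that
      by (simp add: degree_nbhd)
    moreover have "degree E u > 0" using degree_pos[OF simple that] by simp
    moreover have "card (insert u (nbhd E u \<inter> nbhd E v)) \<le> card (nbhd E u \<inter> nbhd E v) + 1"
      by (simp add: card_insert_le_m1 card_insert_if finite_nbhd[OF simple])
    ultimately show ?thesis by linarith
  qed
  moreover have "card (nbhd E u \<inter> nbhd E v) \<le> degree E u"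
    unfolding degree_nbhd by (intro card_mono finite_nbhd[OF simple]) auto
  ultimately have "degree E' v \<le> degree E u" by (simp add: degree_nbhd[of E'])
  moreover have "degree E' v > 0"
  proof -
    have "nbhd E' v \<noteq> {}" using near nbhd_sym[of u E v] uv by (auto simp: nbhd'_v)
    then show ?thesis using finite_nbhd[OF s'] by (simp add: degree_nbhd card_gt_0_iff)
  qed
  ultimately have cpq: "0 < c" "c \<le> p" "c \<le> q" "p + q = d + c"
    using degree'_u degree'_v by (auto simp: c_def d_def p_def q_def)
  have w: "?w u j = (if j \<in> nbhd E u then f p (real (degree E j)) else 0)"
    "?w v j = (if j \<in> nbhd E v then f q (real (degree E j)) else 0)"
    "?w' u j = (if j \<in> nbhd E u \<union> nbhd E v then f d (real (degree E j)) else 0)"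
    "?w' v j = (if j \<in> nbhd E u \<inter> nbhd E v then f c (real (degree E j)) else 0)"
    if "j \<in> ?R" for j
    using that by (auto simp: edge_weight_def p_def q_def c_def d_def nbhd'_u nbhd'_v degree'_other)
  have dj: "real (degree E j) > 0" if "j \<in> nbhd E u \<or> j \<in> nbhd E v" for j
    using that degree_pos[OF simple] by auto
  note mono = P_star_mono[OF f] and convex = P_star_convex[OF f cpq]
  have fpos: "f d (real (degree E j)) > 0" if "j \<in> nbhd E u \<or> j \<in> nbhd E v" for j
    using P_star_pos[OF f] dj[OF that] cpq by auto
  have le: "?w u j \<le> ?w' u j" "?w v j \<le> ?w' u j" "?w u j + ?w v j \<le> ?w' u j + ?w' v j"
    if j: "j \<in> ?R" for j
    using mono[of p d "real (degree E j)"] mono[of q d "real (degree E j)"]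
      convex[of "real (degree E j)"] dj[of j] fpos[of j] cpq
    by (auto simp: w[OF j])
  have strict: "\<exists>j\<in>?R. ?w u j < ?w' u j" "\<exists>j\<in>?R. ?w v j < ?w' u j"
  proof -
    \<comment> \<open>Private neighbours give strictness: row \<open>u\<close> has weight 0 at
      \<open>a\<close> and row \<open>v\<close> has weight 0 at \<open>b\<close>, while the new row
      \<open>u\<close> is positive at both.\<close>
    obtain a b where ab: "a \<in> nbhd E v" "a \<notin> nbhd E u" "a \<noteq> u" "b \<in> nbhd E u" "b \<notin> nbhd E v" "b \<noteq> v"
      using comp unfolding compressible_def by blast
    then have "a \<in> ?R" "b \<in> ?R" using nbhdD[OF simple] by auto
    then show "\<exists>j\<in>?R. ?w u j < ?w' u j" "\<exists>j\<in>?R. ?w v j < ?w' u j"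
      using w[OF \<open>a \<in> ?R\<close>] w[OF \<open>b \<in> ?R\<close>] fpos[of a] fpos[of b] ab by force+
  qed
  have edge: "?w u v \<le> ?w' u v"
  proof -
    have "v \<in> nbhd E' u \<longleftrightarrow> v \<in> nbhd E u" using nbhdD[OF simple] by (auto simp: nbhd'_u)
    then show ?thesis using P_star_major[OF f cpq] by (simp add: edge_weight_def c_def d_def p_def q_def)
  qed
  have off: "?w' i j = ?w i j" if "i \<in> ?R" "j \<in> ?R" for i j
  proof -
    have "j \<in> nbhd E' i \<longleftrightarrow> j \<in> nbhd E i"
      using that nbhd'_moved[of i] nbhd'_other[of i] by (cases "i \<in> P") auto
    then show ?thesis using that degree'_other by (simp add: edge_weight_def)
  qed
  show ?thesis
    unfolding K unfolding A_f_wmat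
  proof (rule rho_wmat_less_exchange[where u = u and v = v and x = x])
    show "?w i j = ?w j i" "?w' i j = ?w' j i" for i j by (rule edge_weight_sym[OF f])+
    show "?w u u = 0" "?w v v = 0" "?w' u u = 0" "?w' v v = 0"
      by (rule edge_weight_diag[OF simple] edge_weight_diag[OF s'])+
  qed (use uv x off le strict edge in \<open>auto simp: A_f_wmat\<close>)
qed

text \<open>A maximising vector for \<open>E\<close>, carried along the isomorphism, is a test
  vector for \<open>E'\<close> with the same form and norm.\<close>

lemma iso_rho_le:
  assumes f: "property_P_star f" and n: "n > 0" and s: "simple_graph n E" and s': "simple_graph n E'"
    and iso: "graph_iso n E E'"
  shows "rho (A_f f n E) \<le> rho (A_f f n E')"
proof -
  obtain \<pi> where bij: "bij_betw \<pi> {..<n} {..<n}"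
    and \<pi>: "\<And>i j. i < n \<Longrightarrow> j < n \<Longrightarrow> {i, j} \<in> E \<longleftrightarrow> {\<pi> i, \<pi> j} \<in> E'"
    using iso unfolding graph_iso_def by blast
  have inj: "inj_on \<pi> {..<n}" and im: "\<pi> ` {..<n} = {..<n}" using bij by (auto simp: bij_betw_def)
  have deg: "degree E' (\<pi> i) = degree E i" if i: "i < n" for i
  proof -
    have "nbhd E' (\<pi> i) = \<pi> ` nbhd E i"
    proof (intro equalityI subsetI)
      fix k assume k: "k \<in> nbhd E' (\<pi> i)"
      then have "k < n" using nbhdD[OF s'] by blast
      then obtain j where j: "j < n" "k = \<pi> j" using im by (metis imageE lessThan_iff)
      then show "k \<in> \<pi> ` nbhd E i" using \<pi>[OF i j(1)] k by (auto simp: mem_nbhd_iff)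
    next
      fix k assume "k \<in> \<pi> ` nbhd E i"
      then obtain j where j: "j \<in> nbhd E i" "k = \<pi> j" by blast
      then show "k \<in> nbhd E' (\<pi> i)" using \<pi>[OF i, of j] nbhdD[OF s j(1)] by (auto simp: mem_nbhd_iff)
    qed
    moreover have "inj_on \<pi> (nbhd E i)"
      by (rule inj_on_subset[OF inj]) (use nbhdD[OF s] in blast)
    ultimately show ?thesis by (simp add: degree_nbhd card_image)
  qed
  have w: "edge_weight f E' (\<pi> i) (\<pi> j) = edge_weight f E i j" if "i < n" "j < n" for i j
    using that \<pi> deg by (simp add: edge_weight_def mem_nbhd_iff)
  note symE = edge_weight_sym[OF f]
  have "\<exists>x. (\<exists>i<n. x i \<noteq> 0) \<and> qform (edge_weight f E) n x = rho (wmat (edge_weight f E) n) * sqn n x"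
    by (rule rho_wmat_attained[OF n]) (rule symE)
  then obtain x where x: "\<exists>i<n. x i \<noteq> 0" "qform (edge_weight f E) n x = rho (A_f f n E) * sqn n x"
    unfolding A_f_wmat by auto
  define y where "y = x \<circ> the_inv_into {..<n} \<pi>"
  have y: "y (\<pi> i) = x i" if "i < n" for i
    using the_inv_into_f_f[OF inj] that by (simp add: y_def)
  have re: "(\<Sum>i<n. g i) = (\<Sum>i<n. g (\<pi> i))" for g :: "nat \<Rightarrow> real"
    using sum.reindex_bij_betw[OF bij, of g] by simp
  have "qform (edge_weight f E') n y = qform (edge_weight f E) n x"
  proof -
    have "qform (edge_weight f E') n y
        = (\<Sum>i<n. \<Sum>j<n. edge_weight f E' (\<pi> i) (\<pi> j) * y (\<pi> i) * y (\<pi> j))"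
      unfolding qform_def re[of "\<lambda>i. \<Sum>j<n. edge_weight f E' i j * y i * y j"]
      by (intro sum.cong refl re)
    also have "\<dots> = qform (edge_weight f E) n x"
      unfolding qform_def by (intro sum.cong refl) (simp add: w y)
    finally show ?thesis .
  qed
  moreover have "qform (edge_weight f E') n y \<le> rho (wmat (edge_weight f E') n) * sqn n y"
    by (rule rho_wmat_bound[OF n]) (rule symE)
  moreover have "sqn n y = sqn n x" unfolding sqn_def re[of "\<lambda>i. (y i)\<^sup>2"] by (simp add: y)
  ultimately have "rho (A_f f n E) * sqn n x \<le> rho (A_f f n E') * sqn n x"
    using x(2) by (simp add: A_f_wmat)
  moreover have "sqn n x > 0" using x(1) by (simp add: sqn_pos_iff)
  ultimately show ?thesis by simp
qed

section \<open>Diamonds with pendant vertices\<close>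

text \<open>The diamond with pendant sets \<open>L\<close> at \<open>u\<close> and \<open>W\<close>
  at \<open>v\<close>. A singleton \<open>W\<close> gives \<open>B3\<close>; an empty one would give
  \<open>B1\<close>.\<close>

definition diamond_broom :: "nat \<Rightarrow> nat set set \<Rightarrow> nat \<Rightarrow> nat \<Rightarrow> nat \<Rightarrow> nat \<Rightarrow> nat set \<Rightarrow> nat set \<Rightarrow> bool" where
  "diamond_broom n E u v y z L W \<longleftrightarrow>
     distinct [u, v, y, z] \<and> {u, v, y, z} \<inter> (L \<union> W) = {} \<and> L \<inter> W = {} \<and>
     {..<n} = {u, v, y, z} \<union> L \<union> W \<and>
     nbhd E u = {v, y, z} \<union> L \<and> nbhd E v = {u, y, z} \<union> W \<and>
     nbhd E y = {u, v} \<and> nbhd E z = {u, v} \<and>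
     (\<forall>l\<in>L. nbhd E l = {u}) \<and> (\<forall>w\<in>W. nbhd E w = {v})"

lemma diamond_broom_edge_move:
  assumes bic: "bicyclic n E" and br: "diamond_broom n E u v y z L W" and w: "w \<in> W"
  shows "edge_move n E u v {w}"
proof -
  note B = br[unfolded diamond_broom_def]
  have V: "{..<n} = {u, v, y, z} \<union> L \<union> W" using B by (elim conjE)
  have mem: "u \<in> {..<n}" "v \<in> {..<n}" unfolding V by simp_all
  have "u \<noteq> v" "nbhd E u = {v, y, z} \<union> L" "nbhd E v = {u, y, z} \<union> W" "w \<notin> {u, v, y, z} \<union> L"
    using B w by auto
  then show ?thesis using bic mem w unfolding edge_move_def by auto
qed

text \<open>Pushing all pendant edges at \<open>v\<close> to \<open>u\<close> would overshoot, so a single one is moved. This is not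
  a Kelmans transformation: the pendant edges left at \<open>v\<close> lose weight, and the loss is paid for by
  those at \<open>u\<close>, which are at least as many and carry at least as large Perron entries.\<close>
lemma diamond_broom_rho_less:
  assumes f: "property_P_star f" and bic: "bicyclic n E"
    and br: "diamond_broom n E u v y z L W" and LW: "card W \<le> card L" and w0: "w0 \<in> W"
    and W2: "card W \<ge> 2"
  shows "rho (A_f f n E) < rho (A_f f n (move_edges E u v {w0}))"
proof -
  note B = br[unfolded diamond_broom_def]
  have dist: "distinct [u, v, y, z]" using B by (elim conjE)
  have disj: "{u, v, y, z} \<inter> (L \<union> W) = {}" "L \<inter> W = {}" using B by simp_all
  have V: "{..<n} = {u, v, y, z} \<union> L \<union> W" using B by (elim conjE)
  have N: "nbhd E u = {v, y, z} \<union> L" "nbhd E v = {u, y, z} \<union> W" "nbhd E y = {u, v}" "nbhd E z = {u, v}"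
      "\<And>l. l \<in> L \<Longrightarrow> nbhd E l = {u}" "\<And>w. w \<in> W \<Longrightarrow> nbhd E w = {v}"
    using B by simp_all
  have mem: "u \<in> {..<n}" "v \<in> {..<n}" unfolding V by simp_all
  interpret edge_move n E u v "{w0}"
    by (rule diamond_broom_edge_move[OF bic br w0])
  have s': "simple_graph n E'" using bicyclic' by (simp add: bicyclic_def)
  have fin: "finite L" "finite W" using V by (metis finite_Un finite_lessThan)+
  obtain x where x: "\<And>i. i < n \<Longrightarrow> x i > 0"
    "\<And>i. i < n \<Longrightarrow> (\<Sum>j<n. edge_weight f E i j * x j) = rho (A_f f n E) * x i"
    using perron_graph[OF f simple conn] uv by (metis gr_zeroI not_less_zero)
  have xpos: "x j > 0" if "j \<in> {u, v, y, z} \<union> L \<union> W" for j using x(1)[of j] that V by blast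
  define r where "r = rho (A_f f n E)"
  define s t where "s = real (card L)" and "t = real (card W)"
  have st: "t \<le> s" "t \<ge> 2" using LW W2 by (auto simp: s_def t_def)
  have card_insert3: "card ({a, b, c} \<union> S) = card S + 3"
    if "finite S" "a \<notin> S" "b \<notin> S" "c \<notin> S" "a \<noteq> b" "a \<noteq> c" "b \<noteq> c" for a b c :: nat and S
    using that by simp
  have deg: "real (degree E u) = s + 3" "real (degree E v) = t + 3"
    "real (degree E y) = 2" "real (degree E z) = 2"
    "\<And>l. l \<in> L \<Longrightarrow> real (degree E l) = 1" "\<And>w. w \<in> W \<Longrightarrow> real (degree E w) = 1"
    unfolding degree_nbhd s_def t_def using dist disj fin by (auto simp: N card_insert3)
  have deg': "real (degree E' u) = s + 4" "real (degree E' v) = t + 2"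
    using degree'_u degree'_v deg by auto
  \<comment> \<open>Weights of pendant edges: \<open>a\<close> at \<open>u\<close> and
    \<open>b\<close> at \<open>v\<close>. The digit is the part of the hub's degree beyond
    \<open>s\<close> or \<open>t\<close>, which is 3 before the move and 4 or 2 after it.\<close>
  define a3 b3 a4 b2 where "a3 = f (s + 3) 1" and "b3 = f (t + 3) 1" and "a4 = f (s + 4) 1"
    and "b2 = f (t + 2) 1"
  have ab: "b2 > 0" "b2 \<le> b3" "b3 \<le> a3" "a3 \<le> a4" "a3 + b3 \<le> a4 + b2"
    using st P_star_pos[OF f] P_star_mono[OF f] P_star_convex[OF f, of "t + 2" "s + 3" "t + 3" "s + 4" 1]
    by (auto simp: a3_def b3_def a4_def b2_def)
  define g where "g = f (s + 3) (t + 3)"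
  have g: "g > 0" using st P_star_pos[OF f] by (simp add: g_def)
  have row: "(\<Sum>j\<in>nbhd E i. f (real (degree E i)) (real (degree E j)) * x j) = r * x i" if "i \<in> {..<n}" for i
    using x(2)[of i] that sum_edge_weight[OF simple, of f i x] by (simp add: r_def)
  have leafL: "r * x l = a3 * x u" if "l \<in> L" for l
  proof -
    have "l \<in> {..<n}" unfolding V using that by simp
    from row[OF this] show ?thesis using that
      by (simp add: N deg a3_def P_star_sym[OF f, of 1])
  qed
  have leafW: "r * x w = b3 * x v" if "w \<in> W" for w
  proof -
    have "w \<in> {..<n}" unfolding V using that by simp
    from row[OF this] show ?thesis using that
      by (simp add: N deg b3_def P_star_sym[OF f, of 1])
  qed
  have rpos: "r > 0"
  proof -
    have "r * x w0 > 0" using leafW[OF w0] ab xpos[of v] by simp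
    then show ?thesis using xpos[of w0] w0 by (simp add: zero_less_mult_iff)
  qed
  \<comment> \<open>The eigenvalue equation at a pendant vertex expresses its entry by that of its
    hub, which turns the equations at the hubs into equations between entries of the diamond
    only.\<close>
  have XL: "x l = a3 * x u / r" if "l \<in> L" for l using leafL[OF that] rpos by (simp add: field_simps)
  have XW: "x w = b3 * x v / r" if "w \<in> W" for w using leafW[OF that] rpos by (simp add: field_simps)
  have rowu: "r * x u = g * x v + (f (s + 3) 2 * (x y + x z) + s * (a3 * (a3 * x u / r)))"
  proof -
    have "(\<Sum>j\<in>L. f (s + 3) (real (degree E j)) * x j) = (\<Sum>j\<in>L. a3 * (a3 * x u / r))"
      by (intro sum.cong refl) (simp add: deg XL a3_def)
    then show ?thesis
      using row[OF mem(1)] dist disj fin by (simp add: N deg g_def s_def algebra_simps)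
  qed
  have rowv: "r * x v = g * x u + (f (t + 3) 2 * (x y + x z) + t * (b3 * (b3 * x v / r)))"
  proof -
    have "(\<Sum>j\<in>W. f (t + 3) (real (degree E j)) * x j) = (\<Sum>j\<in>W. b3 * (b3 * x v / r))"
      by (intro sum.cong refl) (simp add: deg XW b3_def)
    then show ?thesis
      using row[OF mem(2)] dist disj fin P_star_sym[OF f, of "t + 3" "s + 3"]
      by (simp add: N deg g_def t_def algebra_simps)
  qed
  have yz: "x y + x z > 0" using xpos[of y] xpos[of z] by simp
  \<comment> \<open>If \<open>v\<close> had the larger entry, subtracting the equations of the hubs
    would give r + g at most k/r, whereas the equation at \<open>v\<close> alone forces k/r below
    r.\<close>
  have vu: "x v \<le> x u"
  proof (rule ccontr)
    assume "\<not> x v \<le> x u"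
    then have lt: "x u < x v" by simp
    define k where "k = t * (b3 * b3)"
    have k: "t * (b3 * (b3 * c / r)) = k * c / r" for c by (simp add: k_def)
    have "k * x u \<le> s * (a3 * a3) * x u"
      unfolding k_def using st ab xpos[of u] by (intro mult_right_mono mult_mono) auto
    then have "k * x u / r \<le> s * (a3 * (a3 * x u / r))"
      using rpos divide_right_mono[of "k * x u" "s * (a3 * a3) * x u" r] by (simp add: mult.assoc)
    moreover have "f (t + 3) 2 * (x y + x z) \<le> f (s + 3) 2 * (x y + x z)"
      using st yz by (intro mult_right_mono P_star_mono[OF f]) auto
    ultimately have "r * x u - r * x v \<ge> g * (x v - x u) + k * x u / r - k * x v / r"
      using rowu rowv unfolding k by (simp add: algebra_simps)
    then have "(r + g - k / r) * (x v - x u) \<le> 0" by (simp add: algebra_simps diff_divide_distrib)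
    then have "r + g \<le> k / r" using lt by (simp add: mult_le_0_iff)
    moreover have "k / r * x v < r * x v"
    proof -
      have "f (t + 3) 2 * (x y + x z) > 0" using yz P_star_pos[OF f] st by simp
      moreover have "g * x u > 0" using g xpos[of u] by simp
      ultimately show ?thesis using rowv unfolding k by simp
    qed
    then have "k / r < r" using xpos[of v] mult_less_cancel_right_pos by blast
    ultimately show False using g by simp
  qed
  let ?R = "{..<n} - {u, v}"
  let ?w = "edge_weight f E" and ?w' = "edge_weight f E'"
  have R: "?R = {y, z} \<union> (L \<union> W)" unfolding V using dist disj by auto
  have w: "?w u j = (if j \<in> {y, z} \<union> L then f (s + 3) (real (degree E j)) else 0)"
    "?w v j = (if j \<in> {y, z} \<union> W then f (t + 3) (real (degree E j)) else 0)"
    "?w' u j = (if j \<in> {y, z} \<union> insert w0 L then f (s + 4) (real (degree E j)) else 0)"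
    "?w' v j = (if j \<in> {y, z} \<union> (W - {w0}) then f (t + 2) (real (degree E j)) else 0)"
    if "j \<in> ?R" for j
  proof -
    have j: "j \<noteq> u" "j \<noteq> v" using that by auto
    have "w0 \<noteq> y" "w0 \<noteq> z" using w0 disj by auto
    then show "?w u j = (if j \<in> {y, z} \<union> L then f (s + 3) (real (degree E j)) else 0)"
      "?w v j = (if j \<in> {y, z} \<union> W then f (t + 3) (real (degree E j)) else 0)"
      "?w' u j = (if j \<in> {y, z} \<union> insert w0 L then f (s + 4) (real (degree E j)) else 0)"
      "?w' v j = (if j \<in> {y, z} \<union> (W - {w0}) then f (t + 2) (real (degree E j)) else 0)"
      using j by (auto simp: edge_weight_def nbhd'_u nbhd'_v degree'_other N(1,2) deg(1,2) deg')
  qed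
  have off: "?w' i j = ?w i j" if "i \<in> ?R" "j \<in> ?R" for i j
  proof -
    have "j \<in> nbhd E' i \<longleftrightarrow> j \<in> nbhd E i"
      using that nbhd'_moved[of i] nbhd'_other[of i] by (cases "i = w0") auto
    then show ?thesis using that degree'_other by (simp add: edge_weight_def)
  qed
  \<comment> \<open>By convexity, what an edge to \<open>y\<close> or \<open>z\<close> gains at
    \<open>u\<close> is at least what it loses at \<open>v\<close>, and the gain is multiplied by
    the larger entry.\<close>
  have wy: "(?w u j * x u + ?w v j * x v) * x j \<le> (?w' u j * x u + ?w' v j * x v) * x j" if "j = y \<or> j = z" for j
  proof -
    have j: "j \<in> ?R" "real (degree E j) = 2" "x j > 0" using that deg xpos[of j] unfolding R by auto
    have c: "f (s + 3) 2 + f (t + 3) 2 \<le> f (s + 4) 2 + f (t + 2) 2" and m: "f (s + 3) 2 \<le> f (s + 4) 2"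
      using st by (auto intro!: P_star_convex[OF f] P_star_mono[OF f])
    have "(f (t + 3) 2 - f (t + 2) 2) * x v \<le> (f (s + 4) 2 - f (s + 3) 2) * x v"
      using c xpos[of v] by (intro mult_right_mono) auto
    also have "\<dots> \<le> (f (s + 4) 2 - f (s + 3) 2) * x u" using m vu by (intro mult_left_mono) auto
    finally have "f (s + 3) 2 * x u + f (t + 3) 2 * x v \<le> f (s + 4) 2 * x u + f (t + 2) 2 * x v"
      by (simp add: algebra_simps)
    then show ?thesis unfolding w[OF j(1)] using that j by (intro mult_right_mono) auto
  qed
  have sumL: "(\<Sum>j\<in>L. (?w u j * x u + ?w v j * x v) * x j) = s * (a3 * x u * (a3 * x u / r))"
    "(\<Sum>j\<in>L. (?w' u j * x u + ?w' v j * x v) * x j) = s * (a4 * x u * (a3 * x u / r))"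
  proof -
    have "(?w u j * x u + ?w v j * x v) * x j = a3 * x u * (a3 * x u / r)"
      "(?w' u j * x u + ?w' v j * x v) * x j = a4 * x u * (a3 * x u / r)" if "j \<in> L" for j
    proof -
      have j: "j \<in> ?R" "j \<notin> W" "j \<noteq> y" "j \<noteq> z" using that dist disj unfolding R by auto
      show "(?w u j * x u + ?w v j * x v) * x j = a3 * x u * (a3 * x u / r)"
        "(?w' u j * x u + ?w' v j * x v) * x j = a4 * x u * (a3 * x u / r)"
        unfolding w[OF j(1)] using that j XL[OF that] deg by (simp_all add: a3_def a4_def)
    qed
    then show "(\<Sum>j\<in>L. (?w u j * x u + ?w v j * x v) * x j) = s * (a3 * x u * (a3 * x u / r))"
      "(\<Sum>j\<in>L. (?w' u j * x u + ?w' v j * x v) * x j) = s * (a4 * x u * (a3 * x u / r))"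
      by (simp_all add: s_def)
  qed
  define m where "m = b3 * x v / r"
  have leafs: "(?w u j * x u + ?w v j * x v) * x j = b3 * x v * m"
    "(?w' u j * x u + ?w' v j * x v) * x j = (if j = w0 then a4 * x u * m else b2 * x v * m)" if "j \<in> W" for j
  proof -
    have j: "j \<in> ?R" "j \<notin> L" "j \<noteq> y" "j \<noteq> z" using that dist disj unfolding R by auto
    show "(?w u j * x u + ?w v j * x v) * x j = b3 * x v * m"
      "(?w' u j * x u + ?w' v j * x v) * x j = (if j = w0 then a4 * x u * m else b2 * x v * m)"
      unfolding w[OF j(1)] using that j XW[OF that] deg(6)[OF that] deg(6)[OF w0]
      by (simp_all add: b3_def b2_def a4_def m_def)
  qed
  have sumW: "(\<Sum>j\<in>W. (?w u j * x u + ?w v j * x v) * x j) = t * (b3 * x v * m)"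
    by (simp add: leafs t_def)
  have sumW': "(\<Sum>j\<in>W. (?w' u j * x u + ?w' v j * x v) * x j) = a4 * x u * m + (t - 1) * (b2 * x v * m)"
  proof -
    have "real (card (W - {w0})) = t - 1" using w0 fin W2 by (simp add: t_def of_nat_diff)
    then show ?thesis using fin w0 by (simp add: sum.remove[OF _ w0] leafs)
  qed
  have xuv: "x u > 0" "x v > 0" using xpos by auto
  \<comment> \<open>The \<open>t - 1\<close> pendant edges left at \<open>v\<close> lose
    \<open>b3 - b2\<close> each. This is paid for by the \<open>s\<close> pendant edges at
    \<open>u\<close>, which gain at least as much each and have at least as large entries; the moved
    edge itself does not lose.\<close>
  have gain: "s * (a3 * x u * (a3 * x u / r)) + t * (b3 * x v * m)
      \<le> s * (a4 * x u * (a3 * x u / r)) + (a4 * x u * m + (t - 1) * (b2 * x v * m))"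
  proof -
    define h where "h = a3 * x u / r"
    have mm: "0 \<le> m" "m \<le> h"
      using ab rpos vu xuv by (auto simp: m_def h_def intro!: divide_right_mono mult_mono)
    have "(t - 1) * ((b3 - b2) * (x v * m)) \<le> s * ((a4 - a3) * (x u * h))"
      using st ab mm vu xuv by (intro mult_mono) auto
    moreover have "b3 * (x v * m) \<le> a4 * (x u * m)" using ab mm vu xuv by (intro mult_mono) auto
    ultimately show ?thesis unfolding h_def[symmetric] by (simp add: algebra_simps)
  qed
  show "rho (A_f f n E) < rho (A_f f n E')"
    unfolding A_f_wmat
  proof (rule rho_wmat_less[where u = u and v = v and x = x and X = "x u" and Y = "x v"])
    show "?w i j = ?w j i" "?w' i j = ?w' j i" for i j by (rule edge_weight_sym[OF f])+
    show "?w u u = 0" "?w v v = 0" "?w' u u = 0" "?w' v v = 0"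
      by (rule edge_weight_diag[OF simple] edge_weight_diag[OF s'])+
    have split: "(\<Sum>j\<in>?R. h j) = h y + h z + ((\<Sum>j\<in>L. h j) + (\<Sum>j\<in>W. h j))" for h :: "nat \<Rightarrow> real"
    proof -
      have "(\<Sum>j\<in>?R. h j) = (\<Sum>j\<in>{y, z}. h j) + (\<Sum>j\<in>L \<union> W. h j)"
        unfolding R using disj fin by (intro sum.union_disjoint) auto
      then show ?thesis using disj fin dist by (simp add: sum.union_disjoint)
    qed
    show "(\<Sum>j\<in>?R. (?w u j * x u + ?w v j * x v) * x j) \<le> (\<Sum>j\<in>?R. (?w' u j * x u + ?w' v j * x v) * x j)"
      unfolding split sumL sumW sumW' using wy[of y] wy[of z] gain by simp
    have uvE: "?w u v = g" "?w' u v = f (s + 4) (t + 2)"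
      using disj by (auto simp: edge_weight_def nbhd'_u N deg deg' g_def)
    show edge: "?w u v \<le> ?w' u v"
      unfolding uvE g_def using st by (intro P_star_major[OF f]) auto
    have le: "?w u j \<le> ?w' u j" if j: "j \<in> ?R" for j
    proof -
      have "real (degree E j) > 0" using j deg unfolding R by auto
      then show ?thesis unfolding w[OF j]
        using P_star_mono[OF f, of "s + 3" "s + 4" "real (degree E j)"]
          P_star_pos[OF f, of "s + 4" "real (degree E j)"] st by auto
    qed
    have w0R: "w0 \<in> ?R" using w0 unfolding R by simp
    have "?w u w0 < ?w' u w0"
      unfolding w[OF w0R] using w0 disj deg(6)[OF w0] P_star_pos[OF f, of "s + 4" 1] st by auto
    then have "(\<Sum>j\<in>?R. ?w u j * x j) < (\<Sum>j\<in>?R. ?w' u j * x j)"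
      by (intro sum_strict_mono_ex1)
        (use w0R le x(1) in \<open>auto intro!: mult_right_mono mult_strict_right_mono less_imp_le[OF x(1)] bexI[of _ w0]\<close>)
    moreover have "(\<Sum>j<n. ?w u j * x j) = ?w u v * x v + (\<Sum>j\<in>?R. ?w u j * x j)"
      by (simp add: sum_lessThan_split_pair[OF uv] edge_weight_diag[OF simple])
    moreover have "?w u v * x v \<le> ?w' u v * x v" using edge xuv by simp
    ultimately show "rho (wmat ?w n) * x u < ?w' u v * x v + (\<Sum>j\<in>?R. ?w' u j * x j)"
      using x(2)[OF uv(1)] by (simp add: A_f_wmat)
  qed (use uv x off in \<open>auto simp: A_f_wmat\<close>)
qed

section \<open>Graphs without improving Kelmans transformation\<close>

text \<open>\<open>B4\<close> up to labelling: \<open>a\<close> carries the pendant vertices,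
  \<open>b\<close> is the other vertex of degree 2 in the diamond, and \<open>p\<close>,
  \<open>q\<close> are its adjacent vertices.\<close>

definition B4_shape :: "nat \<Rightarrow> nat set set \<Rightarrow> nat \<Rightarrow> nat \<Rightarrow> nat \<Rightarrow> nat \<Rightarrow> bool" where
  "B4_shape n E a b p q \<longleftrightarrow>
     distinct [a, b, p, q] \<and> {a, b, p, q} \<subseteq> {..<n} \<and>
     nbhd E a = {..<n} - {a, b} \<and> nbhd E b = {p, q} \<and>
     nbhd E p = {a, b, q} \<and> nbhd E q = {a, b, p} \<and>
     (\<forall>l\<in>{..<n} - {a, b, p, q}. nbhd E l = {a})"

text \<open>For \<open>n\<close> at least 6 a vertex adjacent to all others means \<open>B1\<close>
  or \<open>B2\<close>, see \<open>full_vertex_iso\<close>. Neighbourhoods are used instead of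
  isomorphisms so that admissibility can be checked after a local change of the graph.\<close>

definition admissible :: "nat \<Rightarrow> nat set set \<Rightarrow> bool" where
  "admissible n E \<longleftrightarrow> bicyclic n E \<and> (\<forall>z<n. nbhd E z \<noteq> {..<n} - {z}) \<and>
     (\<forall>a b p q. \<not> B4_shape n E a b p q)"

lemma B4_shapeD:
  assumes "B4_shape n E a b p q"
  shows "a \<noteq> b" "a \<noteq> p" "a \<noteq> q" "b \<noteq> p" "b \<noteq> q" "p \<noteq> q"
    "a < n" "b < n" "p < n" "q < n"
    "nbhd E a = {..<n} - {a, b}" "nbhd E b = {p, q}" "nbhd E p = {a, b, q}" "nbhd E q = {a, b, p}"
    "\<And>l. l < n \<Longrightarrow> l \<noteq> a \<Longrightarrow> l \<noteq> b \<Longrightarrow> l \<noteq> p \<Longrightarrow> l \<noteq> q \<Longrightarrow> nbhd E l = {a}"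
  using assms by (simp_all add: B4_shape_def)

lemma B4_shape_swap: "B4_shape n E a b p q \<Longrightarrow> B4_shape n E a b q p"
  by (auto simp: B4_shape_def insert_commute)

lemma card_lessThan_minus2: "a < n \<Longrightarrow> b < n \<Longrightarrow> a \<noteq> b \<Longrightarrow> card ({..<n} - {a, b}) = n - 2" for a b n :: nat
  by (subst card_Diff_subset) auto

lemma B4_shape_degrees:
  assumes "B4_shape n E a b p q"
  shows "degree E a = n - 2" "degree E b = 2" "degree E p = 3" "degree E q = 3"
    "z < n \<Longrightarrow> z \<noteq> a \<Longrightarrow> degree E z \<le> 3"
proof -
  note D = B4_shapeD[OF assms]
  show "degree E a = n - 2" using D(1,7,8) by (simp add: degree_nbhd D(11) card_lessThan_minus2)
  show d: "degree E b = 2" "degree E p = 3" "degree E q = 3"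
    unfolding degree_nbhd D(12-14) using D(1-6) by simp_all
  assume z: "z < n" "z \<noteq> a"
  consider "z = b" | "z = p" | "z = q" | "z \<noteq> b" "z \<noteq> p" "z \<noteq> q" by blast
  then show "degree E z \<le> 3"
  proof cases
    case 4
    then show ?thesis using D(15)[OF z] by (simp add: degree_nbhd)
  qed (use d in simp_all)
qed

text \<open>In the graphs excluded by admissibility all pendant vertices share their neighbour.\<close>
lemma admissible_two_pendants:
  assumes bic: "bicyclic n E" and n: "n \<ge> 4" and l: "nbhd E l1 = {c1}" "nbhd E l2 = {c2}" and c: "c1 \<noteq> c2"
  shows "admissible n E"
proof -
  note s = bicyclicD(1)[OF bic]
  have mem: "l1 < n" "l2 < n" using nbhdD[OF s, of c1 l1] nbhdD[OF s, of c2 l2] l by auto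
  have d1: "degree E l1 = 1" "degree E l2 = 1" by (simp_all add: degree_nbhd l)
  have "nbhd E z \<noteq> {..<n} - {z}" if z: "z < n" for z
  proof
    assume full: "nbhd E z = {..<n} - {z}"
    then have "degree E z = n - 1" using z by (simp add: degree_nbhd)
    then have "z \<noteq> l1" "z \<noteq> l2" using d1 n by auto
    then have "l1 \<in> nbhd E z" "l2 \<in> nbhd E z" using mem unfolding full by auto
    then have "z \<in> nbhd E l1" "z \<in> nbhd E l2" using nbhd_sym by blast+
    then show False using l c by simp
  qed
  moreover have "\<not> B4_shape n E a b p q" for a b p q
  proof
    assume B: "B4_shape n E a b p q"
    note D = B4_shapeD[OF B]
    have "nbhd E l = {a}" if "l < n" "degree E l = 1" for l
    proof (rule D(15)[OF that(1)])
      show "l \<noteq> a" using that(2) B4_shape_degrees(1)[OF B] n by auto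
      show "l \<noteq> b" "l \<noteq> p" "l \<noteq> q" using that(2) B4_shape_degrees(2-4)[OF B] by auto
    qed
    from this[OF mem(1) d1(1)] this[OF mem(2) d1(2)] show False using l c by simp
  qed
  ultimately show ?thesis using bic by (simp add: admissible_def)
qed

text \<open>The last item identifies the hub of a transformed graph: no vertex but \<open>u\<close>
  gains degree.\<close>

lemma kelmans_props:
  assumes bic: "bicyclic n E" and comp: "compressible E u v"
  shows "bicyclic n (kelmans E u v)"
    and "nbhd (kelmans E u v) u = nbhd E u \<union> (nbhd E v - {u})"
    and "nbhd (kelmans E u v) v = nbhd E v \<inter> insert u (nbhd E u)"
    and "\<And>w. w \<noteq> u \<Longrightarrow> w \<in> nbhd E v \<Longrightarrow> w \<notin> nbhd E u \<Longrightarrow> nbhd (kelmans E u v) w = insert u (nbhd E w - {v})"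
    and "\<And>w. w \<noteq> u \<Longrightarrow> w \<noteq> v \<Longrightarrow> w \<notin> nbhd E v \<or> w \<in> nbhd E u \<Longrightarrow> nbhd (kelmans E u v) w = nbhd E w"
    and "\<And>w. w \<noteq> u \<Longrightarrow> degree (kelmans E u v) w \<le> degree E w"
proof -
  interpret edge_move n E u v "nbhd E v - insert u (nbhd E u)"
    by (rule compressible_edge_move[OF bic comp])
  have K: "kelmans E u v = E'" by (simp add: kelmans_def)
  show "bicyclic n (kelmans E u v)" unfolding K by (rule bicyclic')
  show "nbhd (kelmans E u v) u = nbhd E u \<union> (nbhd E v - {u})" unfolding K nbhd'_u by auto
  show "nbhd (kelmans E u v) v = nbhd E v \<inter> insert u (nbhd E u)" unfolding K nbhd'_v by auto
  show "nbhd (kelmans E u v) w = insert u (nbhd E w - {v})"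
    if "w \<noteq> u" "w \<in> nbhd E v" "w \<notin> nbhd E u" for w
    unfolding K by (rule nbhd'_moved) (use that in simp)
  show "nbhd (kelmans E u v) w = nbhd E w" if "w \<noteq> u" "w \<noteq> v" "w \<notin> nbhd E v \<or> w \<in> nbhd E u" for w
    unfolding K by (rule nbhd'_other) (use that in auto)
  show "degree (kelmans E u v) w \<le> degree E w" if "w \<noteq> u" for w
    unfolding K using that degree'_other[of w] degree'_v by (cases "w = v") auto
qed

text \<open>Reconstruction rule: once the edges avoiding \<open>u\<close> are listed, all other
  neighbourhoods can be computed.\<close>

lemma nbhd_avoiding_iff:
  "i \<noteq> u \<Longrightarrow> j \<in> nbhd E i \<longleftrightarrow> j = u \<and> i \<in> nbhd E u \<or> {i, j} \<in> edges_avoiding E u"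
  using nbhd_sym[of j E i] by (auto simp: edges_avoiding_def mem_nbhd_iff)

lemma star_edge_iff: "{i, j} \<in> (\<lambda>w. {x, w}) ` S \<longleftrightarrow> i = x \<and> j \<in> S \<or> j = x \<and> i \<in> S"
  by (auto simp: doubleton_eq_iff)

lemma edges_avoidingE:
  assumes "simple_graph n E" "e \<in> edges_avoiding E u"
  obtains i j where "e = {i, j}" "i \<noteq> j" "i < n" "j < n" "i \<noteq> u" "j \<noteq> u" "j \<in> nbhd E i" "i \<in> nbhd E j"
proof -
  have e: "e \<in> E" "u \<notin> e" using assms(2) by (auto simp: edges_avoiding_def)
  then obtain i j where ij: "e = {i, j}" "i \<noteq> j" "i < n" "j < n"
    using assms(1) unfolding simple_graph_def by meson
  have "j \<in> nbhd E i" using e ij by (simp add: mem_nbhd_iff)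
  then show thesis using that[OF ij] e ij nbhd_sym by auto
qed

lemma finite_edges_avoiding: "simple_graph n E \<Longrightarrow> finite (edges_avoiding E u)"
  using finite_simple_graph by (simp add: edges_avoiding_def)

lemma card_nbhd_le_edges_avoiding:
  assumes s: "simple_graph n G" and z: "z \<noteq> u"
  shows "card (nbhd G z - {u}) \<le> card (edges_avoiding G u)"
proof -
  have "card ((\<lambda>j. {z, j}) ` (nbhd G z - {u})) = card (nbhd G z - {u})"
    by (rule card_image) (auto simp: inj_on_def doubleton_eq_iff)
  moreover have "(\<lambda>j. {z, j}) ` (nbhd G z - {u}) \<subseteq> edges_avoiding G u"
    using z by (auto simp: edges_avoiding_def mem_nbhd_iff)
  ultimately show ?thesis using card_mono[OF finite_edges_avoiding[OF s]] by metis
qed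

lemma finite_max_ex:
  fixes g :: "'a \<Rightarrow> 'b :: linorder"
  assumes "finite S" "S \<noteq> {}"
  shows "\<exists>x\<in>S. \<forall>y\<in>S. g y \<le> g x"
proof -
  have "Max (g ` S) \<in> g ` S" using assms by (intro Max_in) auto
  then obtain x where x: "x \<in> S" "g x = Max (g ` S)" by (metis imageE)
  have "\<forall>y\<in>S. g y \<le> g x" unfolding x(2) using assms(1) by simp
  then show ?thesis using x(1) by blast
qed

text \<open>Supplies a pendant vertex outside a configuration on five vertices.\<close>

lemma ex_outside_five:
  fixes n :: nat
  assumes "n \<ge> 6"
  shows "\<exists>l<n. l \<noteq> a \<and> l \<noteq> b \<and> l \<noteq> c \<and> l \<noteq> d \<and> l \<noteq> e"
proof (rule ccontr)
  assume "\<not> ?thesis"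
  then have "{..<n} \<subseteq> {a, b, c, d, e}" by auto
  then have "card {..<n} \<le> card {a, b, c, d, e}" by (intro card_mono) auto
  also have "\<dots> \<le> 5" by (simp add: card_insert_if)
  finally show False using assms by simp
qed

text \<open>Compressible pairs may exist here. Each leads to a graph with a vertex adjacent to all
  others or to \<open>B4\<close>, and these outcomes reveal the structure of
  \<open>E\<close>.\<close>

locale stuck_graph =
  fixes n :: nat and E :: "nat set set"
  assumes n6: "n \<ge> 6" and adm: "admissible n E"
    and stuck: "\<And>u v. compressible E u v \<Longrightarrow> \<not> admissible n (kelmans E u v)"
begin

lemma bic: "bicyclic n E" and noB4: "\<not> B4_shape n E a b p q"
  and nofull: "z < n \<Longrightarrow> nbhd E z \<noteq> {..<n} - {z}"
  using adm by (auto simp: admissible_def)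

lemma simple: "simple_graph n E" and conn: "connected_graph n E" and cardE: "card E = n + 1"
  using bicyclicD[OF bic] by auto

lemmas nbD = nbhdD[OF simple] and fin_nb = finite_nbhd[OF simple]
  and fin_avoiding = finite_edges_avoiding[OF simple]

lemma nb_self: "i \<notin> nbhd E i" using nbD by blast

lemma nb_nonempty: "i < n \<Longrightarrow> \<exists>j. j \<in> nbhd E i"
  using connected_nbhd_nonempty[OF conn] n6 by fastforce

text \<open>The standard way to a contradiction below: a transformation after which two pendant
  vertices have different neighbours would be an admissible improvement.\<close>

lemma stuck_pendants:
  assumes "compressible E u v" "nbhd (kelmans E u v) l1 = {c1}" "nbhd (kelmans E u v) l2 = {c2}" "c1 \<noteq> c2"
  shows False
  using admissible_two_pendants[OF kelmans_props(1)[OF bic assms(1)] _ assms(2-4)] stuck[OF assms(1)] n6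
  by simp

lemma stuck_cases:
  assumes "compressible E u v"
  obtains (full) z where "z < n" "nbhd (kelmans E u v) z = {..<n} - {z}"
  | (shape) a b p q where "B4_shape n (kelmans E u v) a b p q"
  using stuck[OF assms] kelmans_props(1)[OF bic assms] by (auto simp: admissible_def)

lemma degree_full: "z < n \<Longrightarrow> nbhd G z = {..<n} - {z} \<Longrightarrow> degree G z = n - 1"
  by (simp add: degree_nbhd)

subsection \<open>Maximum degree at most \<open>n - 3\<close>\<close>

context
  fixes u :: nat
  assumes u: "u < n" and max: "\<And>w. w < n \<Longrightarrow> degree E w \<le> degree E u" and small: "degree E u \<le> n - 3"
begin

text \<open>All degrees are at most n - 3 and only \<open>x\<close> gains degree, so a vertex of
  degree n - 1 afterwards must be \<open>x\<close>. The same holds for the hub of \<open>B4\<close>,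
  of degree n - 2.\<close>

lemma kelmans_full_hub:
  assumes "compressible E x y" "z < n" "nbhd (kelmans E x y) z = {..<n} - {z}"
  shows "z = x"
  using kelmans_props(6)[OF bic assms(1), of z] max[OF assms(2)] small n6 degree_full[OF assms(2,3)]
  by fastforce

lemma kelmans_shape_hub:
  assumes "compressible E x y" "B4_shape n (kelmans E x y) a b p q"
  shows "a = x"
  using kelmans_props(6)[OF bic assms(1), of a] max[of a] small n6 B4_shape_degrees(1)[OF assms(2)]
    B4_shapeD(7)[OF assms(2)]
  by fastforce

text \<open>As \<open>x\<close> still misses \<open>y\<close> after the move, the outcome is
  \<open>B4\<close> with hub \<open>x\<close> and \<open>b = y\<close>. Undoing the move, the common
  neighbours are the adjacent vertices \<open>p\<close>, \<open>q\<close> and all private neighbours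
  are pendant. Then the transformation from \<open>x\<close> to \<open>p\<close> leaves pendant
  vertices at both \<open>p\<close> and \<open>y\<close>.\<close>

lemma not_compressible_nonadjacent:
  assumes comp: "compressible E x y" and nonadj: "y \<notin> nbhd E x"
  shows False
proof -
  note K = kelmans_props[OF bic comp]
  have xy: "x < n" "y < n" "x \<noteq> y" using compressible_less[OF simple comp] comp by (auto simp: compressible_def)
  have nonadj': "x \<notin> nbhd E y" using nonadj nbhd_sym by blast
  have Kx: "nbhd (kelmans E x y) x = nbhd E x \<union> nbhd E y" using K(2) nonadj' by auto
  have Ky: "nbhd (kelmans E x y) y = nbhd E x \<inter> nbhd E y" using K(3) nonadj' by auto
  have yx: "y \<notin> nbhd (kelmans E x y) x" using Kx nonadj nb_self by auto
  from comp show False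
  proof (cases rule: stuck_cases)
    case (full z)
    then show False using kelmans_full_hub[OF comp full] yx xy by auto
  next
    case (shape a b p q)
    have a: "a = x" by (rule kelmans_shape_hub[OF comp shape])
    note D = B4_shapeD[OF shape, unfolded a]
    have b: "b = y" using yx xy D(11) by auto
    note D = D[unfolded b]
    have common: "nbhd E x \<inter> nbhd E y = {p, q}" using D(12) Ky by simp
    have p: "nbhd E p = {x, y, q}"
    proof -
      have "nbhd (kelmans E x y) p = nbhd E p" by (rule K(5)) (use D(2,4) common in auto)
      then show ?thesis using D(13) by simp
    qed
    obtain l1 where l1: "l1 \<in> nbhd E x" "l1 \<notin> nbhd E y" using comp unfolding compressible_def by blast
    obtain l2 where l2: "l2 \<in> nbhd E y" "l2 \<notin> nbhd E x" using comp unfolding compressible_def by blast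
    have l1': "l1 < n" "l1 \<noteq> x" "l1 \<noteq> y" "l1 \<noteq> p" "l1 \<noteq> q" using l1 nonadj common nbD[OF l1(1)] by auto
    have l2': "l2 < n" "l2 \<noteq> x" "l2 \<noteq> y" "l2 \<noteq> p" "l2 \<noteq> q" using l2 nonadj' common nbD[OF l2(1)] by auto
    have nl1: "nbhd E l1 = {x}"
      using D(15)[OF l1'] K(5)[of l1] l1 l1' by simp
    have nl2: "nbhd E l2 = {y}"
    proof -
      have "insert x (nbhd E l2 - {y}) = {x}"
        using D(15)[OF l2'] K(4)[of l2] l2 l2' by simp
      moreover have "x \<notin> nbhd E l2" "y \<in> nbhd E l2" using l2 nbhd_sym by blast+
      ultimately show ?thesis by blast
    qed
    have x_p: "x \<in> nbhd E p" "p \<in> nbhd E x" "y \<noteq> p" "x \<noteq> p" using p D common by auto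
    have c2: "compressible E p x"
      unfolding compressible_def using x_p p l1 l1' nonadj xy by auto
    note K2 = kelmans_props[OF bic c2]
    have "nbhd (kelmans E p x) l1 = {p}" using K2(4)[of l1] l1 l1' p nl1 by auto
    moreover have "nbhd (kelmans E p x) l2 = {y}" using K2(5)[of l2] l2 l2' nl2 by auto
    ultimately show False using stuck_pendants[OF c2] x_p by blast
  qed
qed

lemma nested_nonadjacent:
  assumes "x \<noteq> y" "y \<notin> nbhd E x" "c \<in> nbhd E x" "c \<in> nbhd E y"
  shows "nbhd E x \<subseteq> nbhd E y \<or> nbhd E y \<subseteq> nbhd E x"
proof -
  have "\<not> compressible E x y" using not_compressible_nonadjacent assms(2) by blast
  moreover have "x \<notin> nbhd E y" using assms(2) nbhd_sym by blast
  ultimately show ?thesis using assms unfolding compressible_def by blast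
qed

definition "W = {..<n} - nbhd E u - {u}"

lemma W_iff: "w \<in> W \<longleftrightarrow> w < n \<and> w \<noteq> u \<and> w \<notin> nbhd E u"
  by (auto simp: W_def)

lemma finite_W: "finite W" by (simp add: W_def)

lemma card_W: "card W + degree E u + 1 = n"
proof -
  have "W = {..<n} - insert u (nbhd E u)" by (auto simp: W_def)
  moreover have "insert u (nbhd E u) \<subseteq> {..<n}" using u nbD by blast
  moreover have "card (insert u (nbhd E u)) = degree E u + 1" using fin_nb nb_self by (simp add: degree_nbhd)
  ultimately show ?thesis
    using card_Diff_subset[of "insert u (nbhd E u)" "{..<n}"] fin_nb card_mono[of "{..<n}" "insert u (nbhd E u)"]
    by simp
qed

lemma W_ge2: "card W \<ge> 2" using card_W small n6 by linarith

text \<open>The vertices satisfying the claim, together with \<open>u\<close> and its neighbours,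
  are closed under adjacency. A vertex of \<open>W\<close> at distance two from \<open>u\<close> has
  a neighbourhood nested with that of \<open>u\<close>, and by maximality of the degree the
  inclusion in \<open>nbhd E u\<close> always holds.\<close>

lemma W_nbhd: "w \<in> W \<Longrightarrow> nbhd E w \<subseteq> nbhd E u"
proof -
  assume w: "w \<in> W"
  define C where "C = insert u (nbhd E u) \<union> {w \<in> W. nbhd E w \<subseteq> nbhd E u}"
  have "w \<in> C"
  proof (rule connected_closed_set[OF conn u])
    show "w < n" using w by (simp add: W_iff)
    show "u \<in> C" by (simp add: C_def)
    fix a b assume a: "a \<in> C" and b: "b \<in> nbhd E a"
    show "b \<in> C"
    proof (cases "b = u \<or> b \<in> nbhd E u")
      case True then show ?thesis by (auto simp: C_def)
    next
      case False
      then have bW: "b \<in> W" using nbD[OF b] by (simp add: W_iff)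
      have "a \<in> nbhd E u" using a b False by (auto simp: C_def)
      moreover have "a \<in> nbhd E b" using b nbhd_sym by blast
      ultimately have "nbhd E u \<subseteq> nbhd E b \<or> nbhd E b \<subseteq> nbhd E u"
        using nested_nonadjacent[of u b a] False by blast
      moreover have "nbhd E u = nbhd E b" if "nbhd E u \<subseteq> nbhd E b"
        using that max[of b] nbD[OF b] fin_nb by (intro card_seteq) (auto simp: degree_nbhd)
      ultimately show ?thesis using bW by (auto simp: C_def)
    qed
  qed
  then show ?thesis using w by (auto simp: C_def W_iff)
qed

text \<open>The pair \<open>u\<close>, \<open>x\<close> is compressible, since otherwise
  \<open>x\<close> would exceed the maximum degree. If \<open>u\<close> becomes adjacent to all
  others, \<open>W\<close> must have been contained in \<open>nbhd E x\<close>; the outcome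
  \<open>B4\<close> is contradictory.\<close>

lemma W_dominated:
  assumes x: "x \<in> nbhd E u" and w: "w \<in> W" "w \<in> nbhd E x"
  shows "W \<subseteq> nbhd E x"
proof -
  have ux: "u \<in> nbhd E x" "x \<noteq> u" "x < n" using x nbhd_sym nbD[OF x] by auto
  have wu: "w \<noteq> u" "w \<notin> nbhd E u" using w by (auto simp: W_iff)
  have "\<not> nbhd E u \<subseteq> insert x (nbhd E x)"
  proof
    assume "nbhd E u \<subseteq> insert x (nbhd E x)"
    then have sub: "insert u (insert w (nbhd E u - {x})) \<subseteq> nbhd E x" using ux w by auto
    have "card (insert u (insert w (nbhd E u - {x}))) = degree E u - 1 + 2"
      using wu nb_self[of u] fin_nb x by (simp add: degree_nbhd)
    moreover have "degree E u > 0" using degree_pos[OF simple x] by simp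
    ultimately have "degree E u < degree E x"
      using card_mono[OF fin_nb sub] by (simp add: degree_nbhd)
    then show False using max[OF ux(3)] by simp
  qed
  then have comp: "compressible E u x"
    unfolding compressible_def using x ux w wu by blast
  note K = kelmans_props[OF bic comp]
  from comp show ?thesis
  proof (cases rule: stuck_cases)
    case (full z)
    then have "z = u" using kelmans_full_hub[OF comp] by blast
    then have "{..<n} - {u} = nbhd E u \<union> (nbhd E x - {u})" using full K(2) by simp
    then show ?thesis by (auto simp: W_def)
  next
    \<comment> \<open>The vertex \<open>b\<close> missed by \<open>u\<close> is adjacent to
      \<open>p\<close> but not to \<open>x\<close>, so nestedness puts \<open>w\<close> into
      \<open>nbhd E p\<close>. Hence \<open>w\<close> keeps the neighbour \<open>p\<close>, although
      it should be pendant at \<open>u\<close>.\<close>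
    case (shape a b p q)
    have a: "a = u" by (rule kelmans_shape_hub[OF comp shape])
    note D = B4_shapeD[OF shape, unfolded a]
    have bK: "b \<notin> nbhd E u \<union> (nbhd E x - {u})" using D(11) K(2) by auto
    then have b: "b \<in> W" "b \<notin> nbhd E x" "b \<noteq> x" using D(1,8) x by (auto simp: W_iff)
    have nb: "nbhd E b = {p, q}" using K(5)[of b] D(1,12) b by auto
    have pq: "p \<in> nbhd E u" "q \<in> nbhd E u" using W_nbhd[OF b(1)] nb by auto
    have "x \<notin> nbhd E b" using b nbhd_sym by blast
    then have xpq: "x \<noteq> p" "x \<noteq> q" using nb by auto
    have "nbhd E x \<inter> insert u (nbhd E u) = {u}"
      using D(15)[OF ux(3,2)] b(3) xpq K(3) by auto
    then have px: "p \<notin> nbhd E x" using pq D(2) by auto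
    then have "x \<notin> nbhd E p" using nbhd_sym by blast
    moreover have "u \<in> nbhd E p" using pq nbhd_sym by blast
    ultimately have "nbhd E x \<subseteq> nbhd E p \<or> nbhd E p \<subseteq> nbhd E x"
      using nested_nonadjacent[of p x u] xpq ux by auto
    moreover have "b \<in> nbhd E p" using nb nbhd_sym by blast
    ultimately have "w \<in> nbhd E p" using b w by blast
    then have pw: "p \<in> nbhd E w" using nbhd_sym by blast
    have "nbhd (kelmans E u x) w = insert u (nbhd E w - {x})" using K(4) w wu by blast
    then have "p \<in> nbhd (kelmans E u x) w" using pw xpq by blast
    moreover have "nbhd (kelmans E u x) w = {u}"
      by (rule D(15)) (use w wu b pq in \<open>auto simp: W_iff\<close>)
    ultimately show ?thesis using D(2) by auto
  qed
qed

lemma card_avoiding_max: "card (edges_avoiding E u) = card W + 2"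
  using card_edges_avoiding[OF simple, of u] cardE card_W by linarith

text \<open>Two dominating vertices use 2|W| of the |W| + 2 edges avoiding \<open>u\<close>, so |W|
  = 2 and no further edge avoids \<open>u\<close>. In this explicit graph the transformation from
  \<open>w\<close> to \<open>x\<close> makes \<open>w\<close> pendant at \<open>x\<close>, next to a
  pendant vertex at \<open>u\<close>.\<close>

lemma two_dominators:
  assumes x: "x \<in> nbhd E u" "W \<subseteq> nbhd E x" and y: "y \<in> nbhd E u" "W \<subseteq> nbhd E y" and xy: "x \<noteq> y"
  shows False
proof -
  define S where "S = (\<lambda>w. {x, w}) ` W \<union> (\<lambda>w. {y, w}) ` W"
  have xyW: "x \<notin> W" "y \<notin> W" "u \<notin> W" "x \<noteq> u" "y \<noteq> u" using x y nb_self by (auto simp: W_iff)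
  have ci: "card ((\<lambda>w. {z, w}) ` W) = card W" for z
    by (rule card_image) (auto simp: inj_on_def doubleton_eq_iff)
  have "(\<lambda>w. {x, w}) ` W \<inter> (\<lambda>w. {y, w}) ` W = {}" using xy xyW by (auto simp: doubleton_eq_iff)
  then have cS: "card S = 2 * card W" unfolding S_def using finite_W ci by (simp add: card_Un_disjoint)
  have sub: "S \<subseteq> edges_avoiding E u"
    using x y xyW by (auto simp: S_def edges_avoiding_def mem_nbhd_iff)
  have W2: "card W = 2" using card_mono[OF fin_avoiding sub] cS card_avoiding_max W_ge2 by linarith
  have F: "edges_avoiding E u = S" using card_subset_eq[OF fin_avoiding sub] cS card_avoiding_max W2 by simp
  have nb: "j \<in> nbhd E i \<longleftrightarrow> j = u \<and> i \<in> nbhd E u \<or> (i = x \<or> i = y) \<and> j \<in> W \<or> (j = x \<or> j = y) \<and> i \<in> W"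
    if "i \<noteq> u" for i j
    unfolding nbhd_avoiding_iff[OF that] F S_def Un_iff star_edge_iff by blast
  have nx: "nbhd E x = insert u W"
    using x(1) xyW xy by (auto simp: nb)
  have nw: "nbhd E w = {x, y}" if "w \<in> W" for w
  proof -
    have "w \<noteq> u" "w \<notin> nbhd E u" using that by (auto simp: W_iff)
    then show ?thesis using that xyW by (auto simp: nb)
  qed
  obtain w where w: "w \<in> W" using W2 by fastforce
  have wn: "w \<noteq> u" "w \<notin> nbhd E u" "w \<noteq> x" "w \<noteq> y" using w x y by (auto simp: W_iff)
  have "nbhd E u - {x, y} \<noteq> {}"
  proof
    assume "nbhd E u - {x, y} = {}"
    then have "nbhd E u \<subseteq> {x, y}" by blast
    then have "degree E u \<le> card {x, y}" unfolding degree_nbhd by (intro card_mono) auto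
    then show False using card_W W2 n6 xy by simp
  qed
  then obtain l where l: "l \<in> nbhd E u" "l \<noteq> x" "l \<noteq> y" by blast
  have lW: "l \<notin> W" "l \<noteq> u" using l nb_self by (auto simp: W_iff)
  have nl: "nbhd E l = {u}" using l lW by (auto simp: nb)
  have comp: "compressible E x w"
    unfolding compressible_def nx nw[OF w] using w wn xyW xy by auto
  note K = kelmans_props[OF bic comp]
  have "nbhd (kelmans E x w) w = {x}" using K(3) nx nw[OF w] xyW xy by auto
  moreover have "nbhd (kelmans E x w) l = {u}"
    using K(5)[of l] nl nw[OF w] l wn lW w by auto
  ultimately show False using stuck_pendants[OF comp] xyW by blast
qed

text \<open>Only one vertex \<open>x\<close> dominates \<open>W\<close>, so \<open>W\<close>
  consists of pendant vertices at \<open>x\<close>. Two edges avoiding \<open>u\<close> are left,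
  both inside \<open>nbhd E u\<close>; once both contain \<open>x\<close>, the diamond appears.
  Maximality of the degree of \<open>u\<close> gives |W| at most |L|.\<close>

lemma small_degree_broom:
  obtains x y z L where "diamond_broom n E u x y z L W" "card W \<le> card L" "card W \<ge> 2"
proof -
  obtain w0 where w0: "w0 \<in> W" using W_ge2 by fastforce
  then obtain x where "x \<in> nbhd E w0" using nb_nonempty by (auto simp: W_iff)
  then have x: "x \<in> nbhd E u" "w0 \<in> nbhd E x" using W_nbhd[OF w0] nbhd_sym by blast+
  have Wx: "W \<subseteq> nbhd E x" by (rule W_dominated[OF x(1) w0 x(2)])
  have xW: "x \<notin> W" "u \<notin> W" "x \<noteq> u" "x < n" using x nb_self nbD[OF x(1)] by (auto simp: W_iff)
  have uniq: "y = x" if "w \<in> W" "w \<in> nbhd E y" for w y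
  proof -
    have "y \<in> nbhd E u" using that W_nbhd nbhd_sym by blast
    then show ?thesis using two_dominators[OF x(1) Wx _ W_dominated] that by blast
  qed
  have nw: "nbhd E w = {x}" if "w \<in> W" for w
    using uniq[OF that] Wx that nbhd_sym by blast
  define F0 where "F0 = (\<lambda>w. {x, w}) ` W"
  have cF0: "card F0 = card W" unfolding F0_def
    by (rule card_image) (auto simp: inj_on_def doubleton_eq_iff)
  have F0: "F0 \<subseteq> edges_avoiding E u"
    using Wx xW by (auto simp: F0_def edges_avoiding_def mem_nbhd_iff)
  have "card (edges_avoiding E u - F0) = 2"
    using card_Diff_subset[OF finite_subset[OF F0 fin_avoiding] F0] cF0 card_avoiding_max by simp
  then obtain e1 e2 where e12: "edges_avoiding E u - F0 = {e1, e2}" "e1 \<noteq> e2"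
    by (auto simp: card_2_iff)
  have F: "edges_avoiding E u = F0 \<union> {e1, e2}" using e12(1) F0 by blast
  have extra: "\<exists>i j. e = {i, j} \<and> i \<noteq> j \<and> i \<in> nbhd E u \<and> j \<in> nbhd E u \<and> j \<in> nbhd E i"
    if e: "e \<in> edges_avoiding E u" "e \<notin> F0" for e
  proof -
    obtain i j where ij: "e = {i, j}" "i \<noteq> j" "i < n" "j < n" "i \<noteq> u" "j \<noteq> u" "j \<in> nbhd E i" "i \<in> nbhd E j"
      by (rule edges_avoidingE[OF simple e(1)])
    have "i \<notin> W" using nw[of i] ij e(2) by (auto simp: F0_def insert_commute)
    moreover have "j \<notin> W" using nw[of j] ij e(2) by (auto simp: F0_def)
    ultimately have "i \<in> nbhd E u" "j \<in> nbhd E u" using ij by (auto simp: W_iff)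
    then show ?thesis using ij by blast
  qed
  \<comment> \<open>An edge \<open>edge2\<close> avoiding \<open>x\<close> has an end
    \<open>y\<close> adjacent to \<open>x\<close>, by nestedness with \<open>x\<close>. So
    \<open>edge1\<close> joins \<open>x\<close> to \<open>y\<close>, and the transformation from
    \<open>x\<close> to \<open>y\<close> yields pendant vertices at \<open>y\<close> and at
    \<open>u\<close>.\<close>
  have path: False if e: "{edge1, edge2} = {e1, e2}" "x \<notin> edge2" for edge1 edge2
  proof -
    have F': "edges_avoiding E u = F0 \<union> {edge1, edge2}" using F e(1) by simp
    have "edge2 \<in> edges_avoiding E u - F0" "edge1 \<in> edges_avoiding E u - F0" using e12(1) e(1) by auto
    then obtain i j where ij: "edge2 = {i, j}" "i \<noteq> j" "i \<in> nbhd E u" "j \<in> nbhd E u" "j \<in> nbhd E i"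
      using extra by blast
    have ijx: "i \<noteq> x" "j \<noteq> x" using e(2) ij by auto
    have "j \<in> nbhd E x" if "i \<notin> nbhd E x"
    proof -
      have "u \<in> nbhd E x" "u \<in> nbhd E i" using x ij nbhd_sym by blast+
      then have "nbhd E x \<subseteq> nbhd E i \<or> nbhd E i \<subseteq> nbhd E x"
        using nested_nonadjacent[of x i u] ijx that by blast
      moreover have "w0 \<notin> nbhd E i" using uniq[OF w0] ijx by blast
      ultimately show ?thesis using x(2) ij(5) by blast
    qed
    then have "\<exists>y y'. edge2 = {y, y'} \<and> y \<noteq> y' \<and> y \<in> nbhd E u \<and> y' \<in> nbhd E u \<and> y \<in> nbhd E x \<and> y \<noteq> x \<and> y' \<noteq> x"
      using ij ijx by (metis insert_commute)
    then obtain y y' where y: "edge2 = {y, y'}" "y \<noteq> y'" "y \<in> nbhd E u" "y' \<in> nbhd E u" "y \<in> nbhd E x"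
      "y \<noteq> x" "y' \<noteq> x" by blast
    have yW: "y \<notin> W" "y' \<notin> W" "y \<noteq> u" "y' \<noteq> u" using y nb_self by (auto simp: W_iff)
    have "{x, y} \<in> edges_avoiding E u" using y yW xW by (simp add: edges_avoiding_def mem_nbhd_iff)
    moreover have "{x, y} \<notin> F0" using yW xW by (auto simp: F0_def doubleton_eq_iff)
    moreover have "{x, y} \<noteq> edge2" using e(2) by auto
    ultimately have edge1: "edge1 = {x, y}" using F' by auto
    have nb: "j \<in> nbhd E i \<longleftrightarrow> j = u \<and> i \<in> nbhd E u \<or> i = x \<and> j \<in> W \<or> j = x \<and> i \<in> W \<or>
        i = x \<and> j = y \<or> i = y \<and> j = x \<or> i = y \<and> j = y' \<or> i = y' \<and> j = y" if "i \<noteq> u" for i j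
      unfolding nbhd_avoiding_iff[OF that] F' F0_def y(1) edge1
        Un_iff star_edge_iff insert_iff empty_iff doubleton_eq_iff by blast
    have nx: "nbhd E x = insert u (insert y W)"
      using xW(1,3) x(1) y(6,7) by (auto simp: nb)
    have ny: "nbhd E y = {u, x, y'}" using yW(1,3) y(2,3,6) by (auto simp: nb)
    have comp: "compressible E y x"
      unfolding compressible_def nx ny using y yW xW w0 by auto
    note K = kelmans_props[OF bic comp]
    have "nbhd (kelmans E y x) w0 = {y}"
      using K(4)[of w0] w0 x(2) ny yW xW nw[OF w0] by auto
    moreover
    \<comment> \<open>Otherwise \<open>u\<close> has degree at most 3, below the degree |W| + 2 of
      \<open>x\<close>.\<close>
    have "nbhd E u - {x, y, y'} \<noteq> {}"
    proof
      assume "nbhd E u - {x, y, y'} = {}"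
      then have "nbhd E u \<subseteq> {x, y, y'}" by blast
      then have "degree E u \<le> card {x, y, y'}" unfolding degree_nbhd by (intro card_mono) auto
      moreover have "degree E x = card W + 2" unfolding degree_nbhd nx using yW xW finite_W by simp
      ultimately show False using max[of x] xW W_ge2 by (auto simp: card_insert_if split: if_splits)
    qed
    then obtain l where l: "l \<in> nbhd E u" "l \<noteq> x" "l \<noteq> y" "l \<noteq> y'" by blast
    have lW: "l \<notin> W" "l \<noteq> u" using l nb_self by (auto simp: W_iff)
    have nl: "nbhd E l = {u}" using l lW by (auto simp: nb)
    have "nbhd (kelmans E y x) l = {u}" using K(5)[of l] nl l lW nx by auto
    ultimately show False using stuck_pendants[OF comp] yW by blast
  qed
  have "x \<in> e1" "x \<in> e2" using path[of e2 e1] path[of e1 e2] by (auto simp: insert_commute)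
  have other: "\<exists>y. e = {x, y} \<and> y \<noteq> x \<and> y \<in> nbhd E u \<and> y \<in> nbhd E x" if "x \<in> e" "e \<in> {e1, e2}" for e
  proof -
    have "e \<in> edges_avoiding E u" "e \<notin> F0" using e12(1) that by auto
    then obtain i j where ij: "e = {i, j}" "i \<noteq> j" "i \<in> nbhd E u" "j \<in> nbhd E u" "j \<in> nbhd E i"
      using extra by blast
    moreover have "i \<in> nbhd E j" using ij nbhd_sym by blast
    ultimately show ?thesis using that(1) by (metis doubleton_eq_iff insertE singletonD)
  qed
  obtain y where y: "e1 = {x, y}" "y \<noteq> x" "y \<in> nbhd E u" "y \<in> nbhd E x" using other \<open>x \<in> e1\<close> by blast
  obtain z where z: "e2 = {x, z}" "z \<noteq> x" "z \<in> nbhd E u" "z \<in> nbhd E x" using other \<open>x \<in> e2\<close> by blast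
  have yz: "y \<noteq> z" using e12(2) y z by blast
  have yzW: "y \<notin> W" "z \<notin> W" "y \<noteq> u" "z \<noteq> u" using y z nb_self by (auto simp: W_iff)
  define L where "L = nbhd E u - {x, y, z}"
  have LW: "L \<inter> W = {}" by (auto simp: L_def W_iff)
  have nb: "j \<in> nbhd E i \<longleftrightarrow> j = u \<and> i \<in> nbhd E u \<or> i = x \<and> j \<in> W \<or> j = x \<and> i \<in> W \<or>
      i = x \<and> j = y \<or> i = y \<and> j = x \<or> i = x \<and> j = z \<or> i = z \<and> j = x" if "i \<noteq> u" for i j
    unfolding nbhd_avoiding_iff[OF that] F F0_def y(1) z(1)
      Un_iff star_edge_iff insert_iff empty_iff doubleton_eq_iff by blast
  have nx: "nbhd E x = {u, y, z} \<union> W" using xW(1,3) x(1) y(2) z(2) by (auto simp: nb)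
  have ny: "nbhd E y = {u, x}" "nbhd E z = {u, x}"
    using yzW y(2,3) z(2,3) yz by (auto simp: nb)
  have nL: "nbhd E l = {u}" if "l \<in> L" for l
  proof -
    have "l \<noteq> u" "l \<notin> W" using that nb_self by (auto simp: L_def W_iff)
    then show ?thesis using that by (auto simp: L_def nb)
  qed
  have nu: "nbhd E u = {x, y, z} \<union> L" using x y z by (auto simp: L_def)
  have V: "{..<n} = {u, x, y, z} \<union> L \<union> W"
  proof -
    have "{..<n} = insert u (nbhd E u) \<union> W" using u nbD by (auto simp: W_def)
    then show ?thesis unfolding nu by auto
  qed
  have "diamond_broom n E u x y z L W"
    unfolding diamond_broom_def
  proof (intro conjI ballI)
    show "distinct [u, x, y, z]" using xW(3) yzW(3,4) y(2) z(2) yz by simp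
    show "{u, x, y, z} \<inter> (L \<union> W) = {}"
      using xW(1,2) yzW(1,2) nb_self[of u] by (simp add: L_def)
  qed (use V nu nx ny nL nw LW in auto)
  moreover have "card W \<le> card L"
  proof -
    have "degree E x = card W + 3" unfolding degree_nbhd nx using yzW xW yz finite_W y z by simp
    moreover have "degree E u = card L + 3"
    proof -
      have "finite L" "x \<notin> L" "y \<notin> L" "z \<notin> L" using fin_nb by (auto simp: L_def)
      then show ?thesis unfolding degree_nbhd nu using y z yz by simp
    qed
    ultimately show ?thesis using max[OF xW(4)] by simp
  qed
  ultimately show thesis using that W_ge2 by blast
qed

end

subsection \<open>Maximum degree \<open>n - 2\<close>\<close>

context
  fixes u w :: nat
  assumes u: "u < n" and w: "w < n" "w \<noteq> u" and nu: "nbhd E u = {..<n} - {u, w}"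
begin

lemma card_avoiding_hub: "card (edges_avoiding E u) = 3"
proof -
  have "degree E u = n - 2" using u w by (simp add: degree_nbhd nu card_lessThan_minus2)
  then show ?thesis using card_edges_avoiding[OF simple, of u] cardE n6 by linarith
qed

lemma nb_u_iff: "x \<in> nbhd E u \<longleftrightarrow> x < n \<and> x \<noteq> u \<and> x \<noteq> w"
  unfolding nu by auto

lemma u_notin_w: "u \<notin> nbhd E w"
  using nb_u_iff[of w] nbhd_sym by blast

lemma pendant:
  assumes "\<And>l. l < n \<Longrightarrow> l \<notin> S \<Longrightarrow> nbhd E l = {u}" "S \<subseteq> {a, b, c, d, e}"
  obtains l where "l < n" "l \<notin> S" "nbhd E l = {u}"
proof -
  obtain l where "l < n" "l \<noteq> a \<and> l \<noteq> b \<and> l \<noteq> c \<and> l \<noteq> d \<and> l \<noteq> e"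
    using ex_outside_five[OF n6] by blast
  moreover from this have "l \<notin> S" using assms(2) by auto
  ultimately show thesis using assms(1) that by blast
qed

text \<open>The edges avoiding \<open>u\<close> form the path s - w - q - t. Moving \<open>s\<close>
  from \<open>w\<close> to \<open>t\<close> makes \<open>w\<close> pendant at \<open>q\<close>,
  while another vertex is pendant at \<open>u\<close>.\<close>

lemma not_path:
  assumes d: "distinct [u, w, s, q, t]"
    and s: "nbhd E s = {u, w}" and t: "nbhd E t = {u, q}" and wq: "nbhd E w = {s, q}"
    and other: "\<And>l. l < n \<Longrightarrow> l \<notin> {u, w, s, q, t} \<Longrightarrow> nbhd E l = {u}"
  shows False
proof -
  have comp: "compressible E t w"
    unfolding compressible_def t wq using d by auto
  note K = kelmans_props[OF bic comp]
  obtain l where l: "l < n" "l \<notin> {u, w, s, q, t}" "nbhd E l = {u}"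
    by (rule pendant[OF other subset_refl])
  have "nbhd (kelmans E t w) w = {q}" using K(3) d by (auto simp: t wq)
  moreover have "nbhd (kelmans E t w) l = {u}" using K(5)[of l] l by (auto simp: wq)
  ultimately show False using stuck_pendants[OF comp] d by auto
qed

text \<open>A move between neighbours of \<open>u\<close> leaves the neighbourhood of
  \<open>u\<close> unchanged. So the outcome is \<open>B4\<close> with hub \<open>u\<close> and
  missing vertex \<open>w\<close>, and undoing the move gives the configuration of
  \<open>not_path\<close>.\<close>

lemma not_compressible_neighbours:
  assumes x: "x \<in> nbhd E u" and y: "y \<in> nbhd E u"
  shows "\<not> compressible E x y"
proof
  assume comp: "compressible E x y"
  let ?K = "kelmans E x y"
  note K = kelmans_props[OF bic comp]
  have sK: "simple_graph n ?K" using bicyclicD(1)[OF K(1)] .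
  have xn: "x < n" "x \<noteq> u" "x \<noteq> w" and yn: "y < n" "y \<noteq> u" "y \<noteq> w" using x y nb_u_iff by auto
  have xy: "x \<noteq> y" using comp by (simp add: compressible_def)
  have uxy: "u \<in> nbhd E x" "u \<in> nbhd E y" using x y nbhd_sym by blast+
  have Ku: "nbhd ?K u = {..<n} - {u, w}" using K(5)[of u] uxy xn yn nu by auto
  have degKu: "degree ?K u = n - 2" using u w by (simp add: degree_nbhd Ku card_lessThan_minus2)
  have cardKF: "card (edges_avoiding ?K u) = 3"
    using card_edges_avoiding[OF sK, of u] bicyclicD(3)[OF K(1)] degKu n6 by linarith
  from comp show False
  proof (cases rule: stuck_cases)
    case (full z)
    \<comment> \<open>A vertex other than \<open>u\<close> adjacent to all others would lie on n - 2
      edges avoiding \<open>u\<close>, but there are only three.\<close>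
    have "z \<noteq> u" using full(2) Ku w by auto
    then have "card (nbhd ?K z - {u}) = n - 2"
      using full u card_lessThan_minus2[of z n u] by (simp add: Diff_insert2[symmetric] insert_commute)
    then show False using card_nbhd_le_edges_avoiding[OF sK \<open>z \<noteq> u\<close>] cardKF n6 by linarith
  next
    case (shape a b p q)
    have a: "a = u" using B4_shape_degrees(5)[OF shape u] degKu n6 by fastforce
    have "b = w" using B4_shapeD(1,8,11)[OF shape] Ku a w by auto
    then have shape': "B4_shape n ?K u w p q" using shape a by simp
    \<comment> \<open>After the move \<open>x\<close> has a neighbour besides \<open>u\<close>, so
      it is not pendant and may be taken as \<open>p\<close>.\<close>
    obtain r where r: "B4_shape n ?K u w x r"
    proof (cases "x = p \<or> x = q")
      case True
      then show ?thesis using that shape' B4_shape_swap[OF shape'] by blast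
    next
      case False
      then have "nbhd ?K x = {u}" using B4_shapeD(15)[OF shape'] xn by blast
      then show ?thesis using K(2) comp uxy unfolding compressible_def by auto
    qed
    note D = B4_shapeD[OF r]
    have Kx: "nbhd E x \<union> (nbhd E y - {x}) = {u, w, r}" using K(2) D(13) by simp
    obtain \<alpha> where \<alpha>: "\<alpha> \<in> nbhd E x" "\<alpha> \<noteq> y" "\<alpha> \<notin> nbhd E y" using comp unfolding compressible_def by blast
    obtain \<beta> where \<beta>: "\<beta> \<in> nbhd E y" "\<beta> \<noteq> x" "\<beta> \<notin> nbhd E x" using comp unfolding compressible_def by blast
    have \<alpha>\<beta>: "\<alpha> \<noteq> u" "\<beta> \<noteq> u" "\<alpha> \<noteq> \<beta>" "\<beta> \<noteq> y" "\<alpha> \<in> {u, w, r}" "\<beta> \<in> {u, w, r}"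
      using \<alpha> \<beta> uxy nb_self Kx by blast+
    have yr: "y \<noteq> r" using \<alpha>\<beta> \<alpha> by auto
    have "nbhd ?K y = {u}" using D(15)[OF yn] xy yr by auto
    then have Ky: "nbhd E y \<inter> insert x (nbhd E x) = {u}" using K(3) by simp
    then have nonadj: "x \<notin> nbhd E y" "y \<notin> nbhd E x" using xn nbhd_sym by blast+
    have dist: "distinct [u, w, x, r, y]" using D(1-6) yn xy yr by auto
    have other: "nbhd E l = {u}" if l: "l < n" "l \<notin> {u, w, x, r, y}" for l
    proof -
      have "l \<notin> nbhd E y" using l(2) Kx by blast
      then have "nbhd ?K l = nbhd E l" using K(5)[of l] l(2) by auto
      then show ?thesis using D(15)[of l] l by auto
    qed
    have ne: "w \<noteq> r" "w \<noteq> u" "r \<noteq> u" "x \<noteq> r" "x \<noteq> w" using dist by auto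
    \<comment> \<open>The private neighbours of \<open>x\<close> and \<open>y\<close> are
      \<open>w\<close> and \<open>r\<close> in some order; the two cases differ by exchanging
      \<open>x\<close> and \<open>y\<close>.\<close>
    consider "\<alpha> = w" "\<beta> = r" | "\<alpha> = r" "\<beta> = w" using \<alpha>\<beta> by auto
    then show False
    proof cases
      case 1
      have "nbhd E x = {u, w}" "nbhd E y = {u, r}"
        using Kx Ky 1 \<alpha> \<beta> uxy nonadj ne by blast+
      moreover from this have "nbhd E w = {x, r}"
        using K(5)[of w] D(12) xn yn ne by auto
      ultimately show False using not_path[OF dist] other by blast
    next
      case 2
      have nxy: "nbhd E x = {u, r}" "nbhd E y = {u, w}"
        using Kx Ky 2 \<alpha> \<beta> uxy nonadj ne by blast+
      have eq: "insert x (nbhd E w - {y}) = {x, r}"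
        using K(4)[of w] D(12) xn nxy ne by auto
      have yw: "y \<in> nbhd E w" "x \<notin> nbhd E w"
        using nxy nbhd_sym[of w E y] nbhd_sym[of w E x] ne by auto
      have "j \<in> nbhd E w \<longleftrightarrow> j = y \<or> j = r" for j
        using arg_cong[OF eq, of "\<lambda>S. j \<in> S"] yw ne yr by auto
      then have "nbhd E w = {y, r}" by blast
      moreover have "distinct [u, w, y, r, x]" using dist by auto
      ultimately show False using not_path[of y r x] nxy other by blast
    qed
  qed
qed

lemma neighbours_nested:
  assumes "x \<in> nbhd E u" "y \<in> nbhd E u" "x \<noteq> y"
  shows "nbhd E x \<subseteq> insert y (nbhd E y) \<or> nbhd E y \<subseteq> insert x (nbhd E x)"
proof -
  have "u \<in> nbhd E x \<inter> nbhd E y" using assms nbhd_sym by blast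
  then show ?thesis using not_compressible_neighbours[OF assms(1,2)] assms(3)
    unfolding compressible_def by blast
qed

text \<open>A neighbour of maximum degree works: if it failed against \<open>y\<close>, nestedness
  would give \<open>y\<close> a strictly larger degree.\<close>

lemma dominating_neighbour:
  obtains x where "x \<in> nbhd E u" "\<And>y. y \<in> nbhd E u \<Longrightarrow> nbhd E y \<subseteq> insert x (nbhd E x)"
proof -
  have "nbhd E u \<noteq> {}" using nb_nonempty[OF u] by blast
  then obtain x where x: "x \<in> nbhd E u" "\<And>y. y \<in> nbhd E u \<Longrightarrow> degree E y \<le> degree E x"
    using finite_max_ex[OF fin_nb, of u "degree E"] by blast
  have "nbhd E y \<subseteq> insert x (nbhd E x)" if y: "y \<in> nbhd E u" for y
  proof (rule ccontr)
    assume n: "\<not> nbhd E y \<subseteq> insert x (nbhd E x)"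
    then have "x \<noteq> y" by blast
    then have sub: "nbhd E x \<subseteq> insert y (nbhd E y)" using neighbours_nested[OF x(1) y] n by blast
    have "nbhd E x - {y} \<subset> nbhd E y - {x}" using sub n nb_self[of x] by blast
    then have "card (nbhd E x - {y}) < card (nbhd E y - {x})"
      by (intro psubset_card_mono) (simp_all add: fin_nb)
    moreover have "y \<in> nbhd E x \<longleftrightarrow> x \<in> nbhd E y" by (rule nbhd_sym)
    moreover have "degree E x > 0" "degree E y > 0" using degree_pos[OF simple] x(1) y by blast+
    ultimately have "degree E x < degree E y"
      using fin_nb by (cases "y \<in> nbhd E x") (simp_all add: degree_nbhd)
    then show False using x(2)[OF y] by simp
  qed
  then show thesis using that x(1) by blast
qed

text \<open>Three edges avoid \<open>u\<close>. One joins the dominating vertex \<open>x\<close> to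
  \<open>w\<close>, and each of the others joins \<open>x\<close> or \<open>w\<close> to a further
  neighbour of \<open>u\<close>. Only two edges at \<open>x\<close> are possible, which is the
  diamond with \<open>w\<close> pendant at \<open>x\<close>.\<close>

lemma large_degree_broom:
  obtains x y z L where "diamond_broom n E u x y z L {w}"
proof -
  obtain x where x: "x \<in> nbhd E u" and dom: "\<And>y. y \<in> nbhd E u \<Longrightarrow> nbhd E y \<subseteq> insert x (nbhd E x)"
    using dominating_neighbour by blast
  have xn: "x < n" "x \<noteq> u" "x \<noteq> w" using x nb_u_iff by auto
  obtain y0 where y0: "y0 \<in> nbhd E w" using nb_nonempty[OF w(1)] by blast
  have "w \<in> nbhd E x"
  proof (cases "y0 = x")
    case True then show ?thesis using y0 nbhd_sym by blast
  next
    case False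
    have "y0 \<in> nbhd E u" using y0 nbD[OF y0] u_notin_w by (auto simp: nb_u_iff)
    then have "nbhd E y0 \<subseteq> insert x (nbhd E x)" by (rule dom)
    then show ?thesis using y0 nbhd_sym xn by blast
  qed
  then have xw: "{x, w} \<in> edges_avoiding E u" using xn w by (simp add: edges_avoiding_def mem_nbhd_iff)
  \<comment> \<open>An edge \<open>pq\<close> avoiding both \<open>x\<close> and \<open>w\<close>
    would by domination force the edges \<open>xp\<close> and \<open>xq\<close>, four edges in all
    with \<open>xw\<close>.\<close>
  have touch: "x \<in> e \<or> w \<in> e" if e: "e \<in> edges_avoiding E u" for e
  proof (rule ccontr)
    assume h: "\<not> (x \<in> e \<or> w \<in> e)"
    obtain p q where pq: "e = {p, q}" "p \<noteq> q" "p < n" "q < n" "p \<noteq> u" "q \<noteq> u" "q \<in> nbhd E p" "p \<in> nbhd E q"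
      by (rule edges_avoidingE[OF simple e])
    have pqxw: "p \<noteq> x" "q \<noteq> x" "p \<noteq> w" "q \<noteq> w" using h pq(1) by auto
    then have "p \<in> nbhd E u" "q \<in> nbhd E u" using pq by (auto simp: nb_u_iff)
    then have "q \<in> nbhd E x" "p \<in> nbhd E x" using dom pq pqxw by blast+
    then have sub: "{{p, q}, {x, q}, {x, p}, {x, w}} \<subseteq> edges_avoiding E u"
      using pq xn xw e by (auto simp: edges_avoiding_def mem_nbhd_iff)
    have "card {{p, q}, {x, q}, {x, p}, {x, w}} = 4"
      using pq pqxw xn by (simp add: doubleton_eq_iff)
    then show False using card_mono[OF fin_avoiding sub] card_avoiding_hub by simp
  qed
  have "card (edges_avoiding E u - {{x, w}}) = 2" using card_avoiding_hub xw fin_avoiding by simp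
  then obtain e1 e2 where e12: "edges_avoiding E u - {{x, w}} = {e1, e2}" "e1 \<noteq> e2"
    by (auto simp: card_2_iff)
  have F: "edges_avoiding E u = {{x, w}, e1, e2}" using e12(1) xw by blast
  have form: "\<exists>y\<in>nbhd E u. y \<noteq> x \<and> (e = {x, y} \<or> e = {w, y})" if "e \<in> {e1, e2}" for e
  proof -
    have e: "e \<in> edges_avoiding E u" "e \<noteq> {x, w}" using e12(1) that by auto
    obtain p q where pq: "e = {p, q}" "p \<noteq> q" "p < n" "q < n" "p \<noteq> u" "q \<noteq> u"
      by (rule edges_avoidingE[OF simple e(1)])
    have "p \<in> {x, w} \<or> q \<in> {x, w}" using touch[OF e(1)] pq(1) by auto
    then show ?thesis using pq e(2) nb_u_iff[of p] nb_u_iff[of q] by (auto simp: insert_commute)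
  qed
  \<comment> \<open>With a common end \<open>y\<close> this is \<open>B4\<close>, which is excluded;
    with different ends the neighbourhoods of \<open>y\<close> and \<open>y'\<close> are not
    nested.\<close>
  have mixed: False if e: "{{x, y}, {w, y'}} = {e1, e2}" and y: "y \<in> nbhd E u" "y \<noteq> x"
    and y': "y' \<in> nbhd E u" "y' \<noteq> x" for y y'
  proof -
    have F': "edges_avoiding E u = {{x, w}, {x, y}, {w, y'}}" using F e by simp
    have yn: "y < n" "y \<noteq> u" "y \<noteq> w" "y' < n" "y' \<noteq> u" "y' \<noteq> w" using y y' by (simp_all add: nb_u_iff)
    have nb: "j \<in> nbhd E i \<longleftrightarrow> j = u \<and> i \<in> nbhd E u \<or> i = x \<and> j = w \<or> i = w \<and> j = x \<or>
      i = x \<and> j = y \<or> i = y \<and> j = x \<or> i = w \<and> j = y' \<or> i = y' \<and> j = w" if "i \<noteq> u" for i j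
      unfolding nbhd_avoiding_iff[OF that] F' insert_iff empty_iff doubleton_eq_iff by argo
    show False
    proof (cases "y = y'")
      case True
      have "nbhd E w = {x, y}" "nbhd E x = {u, w, y}" "nbhd E y = {u, w, x}"
        using nb[of w] nb[of x] nb[of y] nb_u_iff[of w] x y yn xn w True by auto
      moreover have "nbhd E l = {u}" if "l \<in> {..<n} - {u, w, x, y}" for l
        using that nb[of l] nb_u_iff[of l] True by auto
      ultimately have "B4_shape n E u w x y"
        unfolding B4_shape_def using nu u w xn yn y(2) by simp
      then show False using noB4 by blast
    next
      case False
      have "x \<in> nbhd E y" "w \<in> nbhd E y'" using nb[of y x] nb[of y' w] yn by blast+
      moreover have "w \<notin> nbhd E y" "x \<notin> nbhd E y'"
        using nb[of y w] nb[of y' x] y(2) y'(2) yn xn w False by blast+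
      ultimately show False
        using neighbours_nested[OF y(1) y'(1) False] y(2) y'(2) yn by blast
    qed
  qed
  \<comment> \<open>Here the transformation from \<open>x\<close> to \<open>w\<close> makes
    \<open>x\<close> pendant at \<open>w\<close>, next to a pendant vertex at
    \<open>u\<close>.\<close>
  have star: False if e: "{{w, y}, {w, y'}} = {e1, e2}" and y: "y \<in> nbhd E u" "y \<noteq> x"
    and y': "y' \<in> nbhd E u" "y' \<noteq> x" for y y'
  proof -
    have F': "edges_avoiding E u = {{x, w}, {w, y}, {w, y'}}" using F e by simp
    have yn: "y < n" "y \<noteq> u" "y \<noteq> w" "y' < n" "y' \<noteq> u" "y' \<noteq> w" using y y' by (simp_all add: nb_u_iff)
    have nb: "j \<in> nbhd E i \<longleftrightarrow> j = u \<and> i \<in> nbhd E u \<or> i = x \<and> j = w \<or> i = w \<and> j = x \<or>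
      i = w \<and> j = y \<or> i = y \<and> j = w \<or> i = w \<and> j = y' \<or> i = y' \<and> j = w" if "i \<noteq> u" for i j
      unfolding nbhd_avoiding_iff[OF that] F' insert_iff empty_iff doubleton_eq_iff by argo
    have nw: "nbhd E w = {x, y, y'}" using nb[of w] nb_u_iff[of w] xn w yn by auto
    have nx: "nbhd E x = {u, w}" using nb[of x] x xn y y' by auto
    have comp: "compressible E w x" unfolding compressible_def nw nx using xn w y yn by auto
    note K = kelmans_props[OF bic comp]
    have "nbhd E l = {u}" if "l < n" "l \<notin> {u, w, x, y, y'}" for l
      using that nb[of l] nb_u_iff[of l] by auto
    then obtain l where l: "l < n" "l \<notin> {u, w, x, y, y'}" "nbhd E l = {u}"
      by (rule pendant[OF _ subset_refl])
    have "nbhd (kelmans E w x) x = {w}" using K(3) nw nx w xn yn by auto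
    moreover have "nbhd (kelmans E w x) l = {u}" using K(5)[of l] l nx by auto
    ultimately show False using stuck_pendants[OF comp] w by blast
  qed
  obtain y where y: "y \<in> nbhd E u" "y \<noteq> x" "e1 = {x, y} \<or> e1 = {w, y}" using form[of e1] by blast
  obtain z where z: "z \<in> nbhd E u" "z \<noteq> x" "e2 = {x, z} \<or> e2 = {w, z}" using form[of e2] by blast
  have e: "e1 = {x, y}" "e2 = {x, z}"
    using y z mixed[of y z] mixed[of z y] star[of y z] by (auto simp: insert_commute)
  have yz: "y \<noteq> z" using e12(2) e by blast
  have yzn: "y \<noteq> u" "y \<noteq> w" "z \<noteq> u" "z \<noteq> w" using y(1) z(1) by (simp_all add: nb_u_iff)
  define L where "L = nbhd E u - {x, y, z}"
  have nb: "j \<in> nbhd E i \<longleftrightarrow> j = u \<and> i \<in> nbhd E u \<or> i = x \<and> j = w \<or> i = w \<and> j = x \<or>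
      i = x \<and> j = y \<or> i = y \<and> j = x \<or> i = x \<and> j = z \<or> i = z \<and> j = x" if "i \<noteq> u" for i j
    unfolding nbhd_avoiding_iff[OF that] F e insert_iff empty_iff doubleton_eq_iff by argo
  have nx: "nbhd E x = {u, y, z} \<union> {w}" using nb[of x] x xn y(2) z(2) by auto
  have nyz: "nbhd E y = {u, x}" "nbhd E z = {u, x}"
    using nb[of y] nb[of z] y(1,2) z(1,2) yzn yz by auto
  have nw: "nbhd E w = {x}" using nb[of w] nb_u_iff[of w] w xn yzn by auto
  have nL: "nbhd E l = {u}" if "l \<in> L" for l
    using that nb[of l] nb_u_iff[of l] by (auto simp: L_def)
  have nu': "nbhd E u = {x, y, z} \<union> L" using x y z by (auto simp: L_def)
  have "{..<n} = {u, w} \<union> nbhd E u" using u w nu by auto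
  then have V: "{..<n} = {u, x, y, z} \<union> L \<union> {w}" unfolding nu' by auto
  have "diamond_broom n E u x y z L {w}"
    unfolding diamond_broom_def
  proof (intro conjI ballI)
    show "distinct [u, x, y, z]" using xn yzn y(2) z(2) yz by simp
    show "{u, x, y, z} \<inter> (L \<union> {w}) = {}"
      using w xn yzn nb_self[of u] by (simp add: L_def)
    show "L \<inter> {w} = {}" using nb_u_iff[of w] by (simp add: L_def)
  qed (use V nu' nx nyz nL nw in auto)
  then show thesis using that by blast
qed

end

text \<open>Degree n - 1 is excluded by admissibility, so a maximum degree above n - 3 is n - 2 and
  the vertex attaining it misses exactly one vertex \<open>w\<close>.\<close>

lemma stuck_broom:
  obtains u x y z L W where "diamond_broom n E u x y z L W" "card W \<le> card L" "card W \<ge> 2"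
  | u x y z L w where "diamond_broom n E u x y z L {w}"
proof -
  have "0 \<in> {..<n}" using n6 by simp
  then have ne: "{..<n} \<noteq> {}" by blast
  obtain u where "u \<in> {..<n}" and max: "\<forall>v\<in>{..<n}. degree E v \<le> degree E u"
    using finite_max_ex[OF finite_lessThan ne, of "degree E"] by (elim bexE)
  then have u: "u < n" "\<And>v. v < n \<Longrightarrow> degree E v \<le> degree E u" by simp_all
  show thesis
  proof (cases "degree E u \<le> n - 3")
    case True
    show thesis by (rule small_degree_broom[OF u(1) _ True]) (rule u(2), assumption, rule that(1))
  next
    case False
    have sub: "nbhd E u \<subseteq> {..<n} - {u}" using nbD by blast
    have "nbhd E u \<subset> {..<n} - {u}" using sub nofull[OF u(1)] by blast
    then obtain w where w: "w < n" "w \<noteq> u" "w \<notin> nbhd E u" by blast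
    have "nbhd E u = {..<n} - {u, w}"
    proof (rule card_seteq)
      show "nbhd E u \<subseteq> {..<n} - {u, w}" using sub w by blast
      show "card ({..<n} - {u, w}) \<le> card (nbhd E u)"
        using False u(1) w by (simp add: card_lessThan_minus2 degree_nbhd)
    qed simp
    then show thesis
      by (rule large_degree_broom[OF u(1) w(1,2)]) (rule that(2))
  qed
qed

end

section \<open>Isomorphism with the extremal graphs\<close>

text \<open>Only the special vertices of a graph are matched by hand. The others, which are pendant
  vertices with a common neighbour in the applications, may be matched arbitrarily.\<close>

lemma extend_bij:
  fixes n :: nat
  assumes inj: "inj_on g S" and S: "S \<subseteq> {..<n}" "g ` S \<subseteq> {..<n}"
  shows "\<exists>\<sigma>. bij_betw \<sigma> {..<n} {..<n} \<and> (\<forall>i\<in>S. \<sigma> i = g i) \<and> \<sigma> ` ({..<n} - S) = {..<n} - g ` S"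
proof -
  have fin: "finite S" by (rule finite_subset[OF S(1)]) simp
  have "card ({..<n} - S) = card ({..<n} - g ` S)"
    using S fin by (simp add: card_Diff_subset card_image[OF inj])
  then obtain h where h: "bij_betw h ({..<n} - S) ({..<n} - g ` S)"
    using finite_same_card_bij[of "{..<n} - S" "{..<n} - g ` S"] by auto
  define \<sigma> where "\<sigma> = (\<lambda>i. if i \<in> S then g i else h i)"
  have "bij_betw \<sigma> S (g ` S)" using inj by (simp add: bij_betw_def \<sigma>_def inj_on_def)
  moreover have h': "bij_betw \<sigma> ({..<n} - S) ({..<n} - g ` S)"
    using h by (subst bij_betw_cong[where g = h]) (auto simp: \<sigma>_def)
  ultimately have "bij_betw \<sigma> (S \<union> ({..<n} - S)) (g ` S \<union> ({..<n} - g ` S))"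
    by (rule bij_betw_combine) blast
  moreover have "S \<union> ({..<n} - S) = {..<n}" "g ` S \<union> ({..<n} - g ` S) = {..<n}" using S by auto
  ultimately have "bij_betw \<sigma> {..<n} {..<n}" by simp
  moreover have "\<forall>i\<in>S. \<sigma> i = g i" by (simp add: \<sigma>_def)
  ultimately show ?thesis using bij_betw_imp_surj_on[OF h'] by blast
qed

lemma extend_bij_list:
  fixes n :: nat
  assumes "distinct xs" "set xs \<subseteq> {..<n}"
  shows "\<exists>\<sigma>. bij_betw \<sigma> {..<n} {..<n} \<and> (\<forall>i<length xs. \<sigma> i = xs ! i) \<and>
    \<sigma> ` {length xs..<n} = {..<n} - set xs"
proof -
  have "length xs \<le> n" using card_mono[OF _ assms(2)] distinct_card[OF assms(1)] by simp
  then have S: "{..<length xs} \<subseteq> {..<n}" by auto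
  have im: "(!) xs ` {..<length xs} = set xs" by (auto simp: in_set_conv_nth)
  have "inj_on ((!) xs) {..<length xs}" using assms(1) by (simp add: inj_on_nth)
  moreover have "{..<n} - {..<length xs} = {length xs..<n}" by auto
  ultimately show ?thesis using extend_bij[of "(!) xs" "{..<length xs}" n] S assms(2) by (simp add: im Ball_def)
qed

text \<open>The bijection runs from the standard graph to \<open>E\<close>, since its labels 0, 1,
  2, ... are the explicit ones; the isomorphism is its inverse.\<close>

lemma graph_iso_nbhdI:
  assumes bij: "bij_betw \<sigma> {..<n} {..<n}" and B: "simple_graph n B"
    and nb: "\<And>i. i < n \<Longrightarrow> nbhd E (\<sigma> i) = \<sigma> ` nbhd B i"
  shows "graph_iso n E B"
proof -
  define \<pi> where "\<pi> = the_inv_into {..<n} \<sigma>"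
  have inj: "inj_on \<sigma> {..<n}" using bij by (simp add: bij_betw_def)
  have bij': "bij_betw \<pi> {..<n} {..<n}" unfolding \<pi>_def by (rule bij_betw_the_inv_into[OF bij])
  have \<sigma>\<pi>: "\<sigma> (\<pi> i) = i" if "i < n" for i
    unfolding \<pi>_def by (rule f_the_inv_into_f_bij_betw[OF bij]) (use that in simp)
  have \<pi>n: "\<pi> i < n" if "i < n" for i using bij' that by (auto simp: bij_betw_def)
  have "{i, j} \<in> E \<longleftrightarrow> {\<pi> i, \<pi> j} \<in> B" if ij: "i < n" "j < n" for i j
  proof -
    have "{i, j} \<in> E \<longleftrightarrow> \<sigma> (\<pi> j) \<in> \<sigma> ` nbhd B (\<pi> i)"
      using nb[OF \<pi>n[OF ij(1)]] ij by (simp add: \<sigma>\<pi> mem_nbhd_iff[symmetric])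
    also have "\<dots> \<longleftrightarrow> \<pi> j \<in> nbhd B (\<pi> i)"
      by (rule inj_on_image_mem_iff[OF inj]) (use \<pi>n ij nbhdD[OF B] in auto)
    finally show ?thesis by (simp add: mem_nbhd_iff)
  qed
  then show ?thesis using bij' unfolding graph_iso_def by blast
qed

section \<open>Neighbourhoods of the four named graphs\<close>

lemma star_family_iff: "{i, j} \<in> {{c, k} | k. P k} \<longleftrightarrow> i = c \<and> P j \<or> j = c \<and> P i"
  by (auto simp: doubleton_eq_iff)

lemma diamond_iff:
  "{i, j} \<in> diamond \<longleftrightarrow> (i, j) \<in> {(0, 1), (1, 0), (0, 2), (2, 0), (0, 3), (3, 0), (1, 2), (2, 1), (1, 3), (3, 1)}"
  unfolding diamond_def by (simp add: doubleton_eq_iff)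

lemma simple_graphI:
  assumes "\<And>e. e \<in> E \<Longrightarrow> \<exists>i j. e = {i, j}" "\<And>i j. {i, j} \<in> E \<Longrightarrow> i \<noteq> j \<and> i < n \<and> j < n"
  shows "simple_graph n E"
  unfolding simple_graph_def using assms by metis

lemma B1_props:
  assumes "n \<ge> 6"
  shows "simple_graph n (B1 n)" "nbhd (B1 n) 0 = {1, 2, 3} \<union> {4..<n}" "nbhd (B1 n) 1 = {0, 2, 3}"
    "nbhd (B1 n) 2 = {0, 1}" "nbhd (B1 n) 3 = {0, 1}" "i \<ge> 4 \<Longrightarrow> i < n \<Longrightarrow> nbhd (B1 n) i = {0}"
proof -
  have iff: "{i, j} \<in> B1 n \<longleftrightarrow> {i, j} \<in> diamond \<or> i = 0 \<and> 4 \<le> j \<and> j < n \<or> j = 0 \<and> 4 \<le> i \<and> i < n" for i j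
    unfolding B1_def Un_iff star_family_iff by blast
  show "simple_graph n (B1 n)"
  proof (rule simple_graphI)
    show "\<exists>i j. e = {i, j}" if "e \<in> B1 n" for e using that by (auto simp: B1_def diamond_def)
  qed (use assms in \<open>auto simp: iff diamond_iff\<close>)
  show "nbhd (B1 n) 0 = {1, 2, 3} \<union> {4..<n}" "nbhd (B1 n) 1 = {0, 2, 3}"
    "nbhd (B1 n) 2 = {0, 1}" "nbhd (B1 n) 3 = {0, 1}"
    by (auto simp: nbhd_def iff diamond_iff)
  show "nbhd (B1 n) i = {0}" if "i \<ge> 4" "i < n" using that by (auto simp: nbhd_def iff diamond_iff)
qed

lemma B2_props:
  assumes "n \<ge> 6"
  shows "simple_graph n (B2 n)" "nbhd (B2 n) 0 = {1, 2, 3, 4} \<union> {5..<n}" "nbhd (B2 n) 1 = {0, 2}"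
    "nbhd (B2 n) 2 = {0, 1}" "nbhd (B2 n) 3 = {0, 4}" "nbhd (B2 n) 4 = {0, 3}"
    "i \<ge> 5 \<Longrightarrow> i < n \<Longrightarrow> nbhd (B2 n) i = {0}"
proof -
  have iff: "{i, j} \<in> B2 n \<longleftrightarrow> (i, j) \<in> {(0, 1), (1, 0), (0, 2), (2, 0), (1, 2), (2, 1),
      (0, 3), (3, 0), (0, 4), (4, 0), (3, 4), (4, 3)}
      \<or> i = 0 \<and> 5 \<le> j \<and> j < n \<or> j = 0 \<and> 5 \<le> i \<and> i < n" for i j
    unfolding B2_def Un_iff star_family_iff by (simp add: doubleton_eq_iff)
  show "simple_graph n (B2 n)"
  proof (rule simple_graphI)
    show "\<exists>i j. e = {i, j}" if "e \<in> B2 n" for e using that by (auto simp: B2_def)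
  qed (use assms in \<open>auto simp: iff\<close>)
  show "nbhd (B2 n) 0 = {1, 2, 3, 4} \<union> {5..<n}" "nbhd (B2 n) 1 = {0, 2}"
    "nbhd (B2 n) 2 = {0, 1}" "nbhd (B2 n) 3 = {0, 4}" "nbhd (B2 n) 4 = {0, 3}"
    by (auto simp: nbhd_def iff)
  show "nbhd (B2 n) i = {0}" if "i \<ge> 5" "i < n" using that by (auto simp: nbhd_def iff)
qed

lemma B3_props:
  assumes "n \<ge> 6"
  shows "simple_graph n (B3 n)" "nbhd (B3 n) 0 = {1, 2, 3} \<union> {4..<n - 1}" "nbhd (B3 n) 1 = {0, 2, 3, n - 1}"
    "nbhd (B3 n) 2 = {0, 1}" "nbhd (B3 n) 3 = {0, 1}" "i \<ge> 4 \<Longrightarrow> i < n - 1 \<Longrightarrow> nbhd (B3 n) i = {0}"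
    "nbhd (B3 n) (n - 1) = {1}"
proof -
  have iff: "{i, j} \<in> B3 n \<longleftrightarrow> {i, j} \<in> diamond \<or> i = 0 \<and> 4 \<le> j \<and> j < n - 1 \<or> j = 0 \<and> 4 \<le> i \<and> i < n - 1
      \<or> i = 1 \<and> j = n - 1 \<or> i = n - 1 \<and> j = 1" for i j
    unfolding B3_def Un_iff star_family_iff by (simp add: doubleton_eq_iff)
  show "simple_graph n (B3 n)"
  proof (rule simple_graphI)
    show "\<exists>i j. e = {i, j}" if "e \<in> B3 n" for e using that by (auto simp: B3_def diamond_def)
  qed (use assms in \<open>auto simp: iff diamond_iff\<close>)
  show "nbhd (B3 n) 0 = {1, 2, 3} \<union> {4..<n - 1}" "nbhd (B3 n) 1 = {0, 2, 3, n - 1}"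
    "nbhd (B3 n) 2 = {0, 1}" "nbhd (B3 n) 3 = {0, 1}" "nbhd (B3 n) (n - 1) = {1}"
    using assms by (auto simp: nbhd_def iff diamond_iff)
  show "nbhd (B3 n) i = {0}" if "i \<ge> 4" "i < n - 1" using that by (auto simp: nbhd_def iff diamond_iff)
qed

lemma B4_props:
  assumes "n \<ge> 6"
  shows "simple_graph n (B4 n)" "nbhd (B4 n) 0 = {1, 2, 3}" "nbhd (B4 n) 1 = {0, 2, 3}"
    "nbhd (B4 n) 2 = {0, 1} \<union> {4..<n}" "nbhd (B4 n) 3 = {0, 1}" "i \<ge> 4 \<Longrightarrow> i < n \<Longrightarrow> nbhd (B4 n) i = {2}"
proof -
  have iff: "{i, j} \<in> B4 n \<longleftrightarrow> {i, j} \<in> diamond \<or> i = 2 \<and> 4 \<le> j \<and> j < n \<or> j = 2 \<and> 4 \<le> i \<and> i < n" for i j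
    unfolding B4_def Un_iff star_family_iff by blast
  show "simple_graph n (B4 n)"
  proof (rule simple_graphI)
    show "\<exists>i j. e = {i, j}" if "e \<in> B4 n" for e using that by (auto simp: B4_def diamond_def)
  qed (use assms in \<open>auto simp: iff diamond_iff\<close>)
  show "nbhd (B4 n) 0 = {1, 2, 3}" "nbhd (B4 n) 1 = {0, 2, 3}"
    "nbhd (B4 n) 2 = {0, 1} \<union> {4..<n}" "nbhd (B4 n) 3 = {0, 1}"
    by (auto simp: nbhd_def iff diamond_iff)
  show "nbhd (B4 n) i = {2}" if "i \<ge> 4" "i < n" using that by (auto simp: nbhd_def iff diamond_iff)
qed

section \<open>Recognising the named graphs\<close>

lemma less_four_cases: "i = 0 \<or> i = 1 \<or> i = 2 \<or> i = 3 \<or> i \<ge> 4" for i :: nat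
  by linarith

lemma B4_shape_iso:
  assumes n: "n \<ge> 6" and sh: "B4_shape n E a b p q"
  shows "graph_iso n E (B4 n)"
proof -
  note D = B4_shapeD[OF sh] and B = B4_props[OF n]
  \<comment> \<open>The order follows the labels of \<open>B4\<close>: 0 and 1 are the adjacent
    vertices of degree 3, and 2 carries the pendant vertices.\<close>
  have "distinct [p, q, a, b]" "set [p, q, a, b] \<subseteq> {..<n}" using D by auto
  then obtain \<sigma> where \<sigma>: "bij_betw \<sigma> {..<n} {..<n}" "\<forall>i<length [p, q, a, b]. \<sigma> i = [p, q, a, b] ! i"
    "\<sigma> ` {length [p, q, a, b]..<n} = {..<n} - set [p, q, a, b]"
    using extend_bij_list by blast
  have v: "\<sigma> 0 = p" "\<sigma> 1 = q" "\<sigma> 2 = a" "\<sigma> 3 = b" using \<sigma>(2) by simp_all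
  have im: "\<sigma> ` {4..<n} = {..<n} - {p, q, a, b}" using \<sigma>(3) by (simp add: numeral_eq_Suc)
  show ?thesis
  proof (rule graph_iso_nbhdI[OF \<sigma>(1) B(1)])
    fix i assume "i < n"
    consider "i = 0" | "i = 1" | "i = 2" | "i = 3" | "i \<ge> 4" using less_four_cases[of i] by blast
    then show "nbhd E (\<sigma> i) = \<sigma> ` nbhd (B4 n) i"
    proof cases
      case 3
      have "nbhd E a = {p, q} \<union> ({..<n} - {p, q, a, b})"
        unfolding D(11) using D(1-10) by auto
      then show ?thesis unfolding 3 v B(4) image_Un im by (simp add: v del: One_nat_def)
    next
      case 5
      then have "\<sigma> i \<in> {..<n} - {p, q, a, b}" using im \<open>i < n\<close> by (metis atLeastLessThan_iff imageI)
      then show ?thesis using B(6)[OF 5 \<open>i < n\<close>] D(15)[of "\<sigma> i"] v by simp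
    qed (use B D v in \<open>simp_all add: insert_commute\<close>)
  qed
qed

lemma diamond_broom_iso:
  assumes n: "n \<ge> 6" and br: "diamond_broom n E u v y z L {w}"
  shows "graph_iso n E (B3 n)"
proof -
  note D = br[unfolded diamond_broom_def] and B = B3_props[OF n]
  have V: "{..<n} = {u, v, y, z} \<union> L \<union> {w}" using D by (elim conjE)
  have "distinct [u, v, y, z]" using D by (elim conjE)
  moreover have "{u, v, y, z} \<inter> (L \<union> {w}) = {}" "L \<inter> {w} = {}" using D by simp_all
  ultimately have d: "distinct [u, v, y, z, w]" "{u, v, y, z, w} \<inter> L = {}" by auto
  have nb: "nbhd E u = {v, y, z} \<union> L" "nbhd E v = {u, y, z} \<union> {w}" "nbhd E y = {u, v}" "nbhd E z = {u, v}"
    "\<And>l. l \<in> L \<Longrightarrow> nbhd E l = {u}" "nbhd E w = {v}" using D by simp_all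
  \<comment> \<open>In \<open>B3\<close> the pendant vertex at 1 is labelled \<open>n - 1\<close>,
    so the special labels do not form an initial segment.\<close>
  define g where "g = (\<lambda>i. if i = n - 1 then w else [u, v, y, z] ! i)"
  let ?S = "{0, 1, 2, 3, n - 1}"
  have gS: "g 0 = u" "g 1 = v" "g 2 = y" "g 3 = z" "g (n - 1) = w" using n by (auto simp: g_def)
  have gim: "g ` ?S = {u, v, y, z, w}" using gS by simp
  have "card (g ` ?S) = 5" unfolding gim using d(1) by simp
  moreover have "card ?S = 5" using n by auto
  ultimately have inj: "inj_on g ?S" by (intro eq_card_imp_inj_on) simp_all
  have sub: "?S \<subseteq> {..<n}" using n by auto
  have "g ` ?S \<subseteq> {..<n}" unfolding gim V by auto
  from extend_bij[OF inj sub this] obtain \<sigma> where \<sigma>: "bij_betw \<sigma> {..<n} {..<n}"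
    "\<forall>i\<in>?S. \<sigma> i = g i" "\<sigma> ` ({..<n} - ?S) = {..<n} - g ` ?S"
    by (elim exE conjE)
  have v: "\<sigma> 0 = u" "\<sigma> 1 = v" "\<sigma> 2 = y" "\<sigma> 3 = z" "\<sigma> (n - 1) = w" using \<sigma>(2) gS by simp_all
  have "{..<n} - ?S = {4..<n - 1}" using n by auto
  moreover have "{..<n} - g ` ?S = L" unfolding gim V using d(2) by auto
  ultimately have im: "\<sigma> ` {4..<n - 1} = L" using \<sigma>(3) by simp
  show ?thesis
  proof (rule graph_iso_nbhdI[OF \<sigma>(1) B(1)])
    fix i assume "i < n"
    then consider "i = 0" | "i = 1" | "i = 2" | "i = 3" | "i = n - 1" | "i \<ge> 4" "i < n - 1"
      using less_four_cases[of i] by linarith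
    then show "nbhd E (\<sigma> i) = \<sigma> ` nbhd (B3 n) i"
    proof cases
      case 1
      then show ?thesis unfolding 1 v nb B(2) image_Un im by (simp add: v del: One_nat_def)
    next
      case 6
      then have "\<sigma> i \<in> L" using im by (metis atLeastLessThan_iff imageI)
      then show ?thesis using B(6)[OF 6] nb(5) v by simp
    qed (use B nb v in \<open>simp_all add: insert_commute\<close>)
  qed
qed

text \<open>Exactly two edges avoid \<open>u\<close>: sharing an endpoint they give
  \<open>B1\<close>, and disjoint they give \<open>B2\<close>.\<close>

lemma full_vertex_iso:
  assumes bic: "bicyclic n E" and n: "n \<ge> 6" and u: "u < n" and full: "nbhd E u = {..<n} - {u}"
  shows "graph_iso n E (B1 n) \<or> graph_iso n E (B2 n)"
proof -
  note s = bicyclicD(1)[OF bic]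
  have "degree E u = n - 1" using u by (simp add: degree_nbhd full)
  then have "card (edges_avoiding E u) = 2"
    using card_edges_avoiding[OF s, of u] bicyclicD(3)[OF bic] n by linarith
  then obtain e1 e2 where F: "edges_avoiding E u = {e1, e2}" "e1 \<noteq> e2" by (auto simp: card_2_iff)
  obtain a b where ab: "e1 = {a, b}" "a \<noteq> b" "a < n" "b < n" "a \<noteq> u" "b \<noteq> u"
    by (rule edges_avoidingE[OF s, of e1 u]) (use F in auto)
  obtain c d where cd: "e2 = {c, d}" "c \<noteq> d" "c < n" "d < n" "c \<noteq> u" "d \<noteq> u"
    by (rule edges_avoidingE[OF s, of e2 u]) (use F in auto)
  have path: "graph_iso n E (B1 n)"
    if F: "edges_avoiding E u = {{v, x}, {v, y}}" and dist: "distinct [u, v, x, y]"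
      and lt: "v < n" "x < n" "y < n" for v x y
  proof -
    note B = B1_props[OF n]
    have nb: "j \<in> nbhd E i \<longleftrightarrow> j = u \<and> i < n \<or> i = v \<and> j = x \<or> i = x \<and> j = v \<or>
        i = v \<and> j = y \<or> i = y \<and> j = v" if "i \<noteq> u" for i j
      unfolding nbhd_avoiding_iff[OF that] F insert_iff empty_iff doubleton_eq_iff full using that by auto
    have nv: "nbhd E v = {u, x, y}" "nbhd E x = {u, v}" "nbhd E y = {u, v}"
      using nb[of v] nb[of x] nb[of y] dist lt by auto
    have nl: "nbhd E l = {u}" if "l < n" "l \<notin> {u, v, x, y}" for l
      using nb[of l] that by auto
    have "set [u, v, x, y] \<subseteq> {..<n}" using u lt by auto
    with dist obtain \<sigma> where \<sigma>: "bij_betw \<sigma> {..<n} {..<n}"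
      "\<forall>i<length [u, v, x, y]. \<sigma> i = [u, v, x, y] ! i"
      "\<sigma> ` {length [u, v, x, y]..<n} = {..<n} - set [u, v, x, y]"
      using extend_bij_list by blast
    have v: "\<sigma> 0 = u" "\<sigma> 1 = v" "\<sigma> 2 = x" "\<sigma> 3 = y"
      using \<sigma>(2) by simp_all
    have im: "\<sigma> ` {4..<n} = {..<n} - {u, v, x, y}" using \<sigma>(3) by (simp add: numeral_eq_Suc)
    show ?thesis
    proof (rule graph_iso_nbhdI[OF \<sigma>(1) B(1)])
      fix i assume "i < n"
      consider "i = 0" | "i = 1" | "i = 2" | "i = 3" | "i \<ge> 4" using less_four_cases[of i] by blast
      then show "nbhd E (\<sigma> i) = \<sigma> ` nbhd (B1 n) i"
      proof cases
        case 1
        have "nbhd E u = {v, x, y} \<union> ({..<n} - {u, v, x, y})" using full dist lt by auto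
        then show ?thesis unfolding 1 v B(2) image_Un im by (simp add: v del: One_nat_def)
      next
        case 5
        then have "\<sigma> i \<in> {..<n} - {u, v, x, y}" using im \<open>i < n\<close> by (metis atLeastLessThan_iff imageI)
        then show ?thesis using B(6)[OF 5 \<open>i < n\<close>] nl[of "\<sigma> i"] v by simp
      qed (use B nv v in \<open>simp_all add: insert_commute\<close>)
    qed
  qed
  have matching: "graph_iso n E (B2 n)" if dist: "distinct [u, a, b, c, d]"
  proof -
    note B = B2_props[OF n]
    have nb: "j \<in> nbhd E i \<longleftrightarrow> j = u \<and> i < n \<or> i = a \<and> j = b \<or> i = b \<and> j = a \<or>
        i = c \<and> j = d \<or> i = d \<and> j = c" if "i \<noteq> u" for i j
      unfolding nbhd_avoiding_iff[OF that] F(1) ab(1) cd(1) insert_iff empty_iff doubleton_eq_iff full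
      using that by auto
    have nv: "nbhd E a = {u, b}" "nbhd E b = {u, a}" "nbhd E c = {u, d}" "nbhd E d = {u, c}"
      using nb[of a] nb[of b] nb[of c] nb[of d] dist ab(3,4) cd(3,4) by auto
    have nl: "nbhd E l = {u}" if "l < n" "l \<notin> {u, a, b, c, d}" for l
      using nb[of l] that by auto
    have "set [u, a, b, c, d] \<subseteq> {..<n}" using u ab cd by auto
    with dist obtain \<sigma> where \<sigma>: "bij_betw \<sigma> {..<n} {..<n}"
      "\<forall>i<length [u, a, b, c, d]. \<sigma> i = [u, a, b, c, d] ! i"
      "\<sigma> ` {length [u, a, b, c, d]..<n} = {..<n} - set [u, a, b, c, d]"
      using extend_bij_list by blast
    have v: "\<sigma> 0 = u" "\<sigma> 1 = a" "\<sigma> 2 = b" "\<sigma> 3 = c" "\<sigma> 4 = d"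
      using \<sigma>(2) by simp_all
    have im: "\<sigma> ` {5..<n} = {..<n} - {u, a, b, c, d}" using \<sigma>(3) by (simp add: numeral_eq_Suc)
    show ?thesis
    proof (rule graph_iso_nbhdI[OF \<sigma>(1) B(1)])
      fix i assume "i < n"
      consider "i = 0" | "i = 1" | "i = 2" | "i = 3" | "i = 4" | "i \<ge> 5" using less_four_cases[of i] by linarith
      then show "nbhd E (\<sigma> i) = \<sigma> ` nbhd (B2 n) i"
      proof cases
        case 1
        have "nbhd E u = {a, b, c, d} \<union> ({..<n} - {u, a, b, c, d})" using full dist ab(3,4) cd(3,4) by auto
        then show ?thesis unfolding 1 v B(2) image_Un im by (simp add: v del: One_nat_def)
      next
        case 6
        then have "\<sigma> i \<in> {..<n} - {u, a, b, c, d}" using im \<open>i < n\<close> by (metis atLeastLessThan_iff imageI)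
        then show ?thesis using B(7)[OF 6 \<open>i < n\<close>] nl[of "\<sigma> i"] v by simp
      qed (use B nv v in \<open>simp_all add: insert_commute\<close>)
    qed
  qed
  show ?thesis
  proof (cases "distinct [u, a, b, c, d]")
    case True
    then show ?thesis using matching by blast
  next
    case False
    then have "a = c \<or> a = d \<or> b = c \<or> b = d" using ab cd by auto
    moreover have "{a, b} \<noteq> {c, d}" using F ab cd by simp
    moreover have F': "edges_avoiding E u = {{a, b}, {c, d}}" using F ab cd by simp
    ultimately consider "a = c" "b \<noteq> d" | "a = d" "b \<noteq> c" | "b = c" "a \<noteq> d" | "b = d" "a \<noteq> c"
      by (auto simp: doubleton_eq_iff)
    then show ?thesis
    proof cases
      case 1
      then show ?thesis using path[of a b d] F' ab cd by simp
    next
      case 2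
      then show ?thesis using path[of a b c] F' ab cd by (simp add: insert_commute)
    next
      case 3
      then show ?thesis using path[of b a d] F' ab cd by (simp add: insert_commute)
    next
      case 4
      then show ?thesis using path[of b a c] F' ab cd by (simp add: insert_commute)
    qed
  qed
qed

section \<open>The extremal graph\<close>

lemma admissible_improve:
  assumes f: "property_P_star f" and n: "n \<ge> 6" and adm: "admissible n E" and nB3: "\<not> graph_iso n E (B3 n)"
  shows "\<exists>E'. admissible n E' \<and> rho (A_f f n E) < rho (A_f f n E')"
proof (cases "\<exists>u v. compressible E u v \<and> admissible n (kelmans E u v)")
  case True
  then show ?thesis using kelmans_rho_less[OF f] adm unfolding admissible_def by metis
next
  case False
  have bic: "bicyclic n E" using adm by (simp add: admissible_def)
  interpret stuck_graph n E by unfold_locales (use n adm False in auto)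
  show ?thesis
  proof (rule stuck_broom)
    fix u x y z L W
    assume br: "diamond_broom n E u x y z L W" and LW: "card W \<le> card L" "card W \<ge> 2"
    \<comment> \<open>One of the two is moved; the other stays pendant at \<open>x\<close>, while
      \<open>l\<close> is pendant at \<open>u\<close>, so the result is again admissible.\<close>
    obtain w w' where w: "w \<in> W" "w' \<in> W" "w \<noteq> w'"
      using LW(2) by (metis One_nat_def Suc_1 card_2_iff' obtain_subset_with_card_n subset_iff)
    have "L \<noteq> {}" using LW by auto
    then obtain l where l: "l \<in> L" by blast
    interpret M: edge_move n E u x "{w}" by (rule diamond_broom_edge_move[OF bic br w(1)])
    note D = br[unfolded diamond_broom_def]
    have disj: "{u, x, y, z} \<inter> (L \<union> W) = {}" "L \<inter> W = {}" and xu: "x \<noteq> u"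
      and nb: "nbhd E w' = {x}" "nbhd E l = {u}"
      using D w l by simp_all
    have "nbhd M.E' w' = {x}" using M.nbhd'_other[of w'] disj nb w by auto
    moreover have "nbhd M.E' l = {u}" using M.nbhd'_other[of l] disj nb w l by auto
    moreover note xu
    ultimately have "admissible n M.E'"
      using admissible_two_pendants[OF M.bicyclic' _ ] n by auto
    then show ?thesis using diamond_broom_rho_less[OF f bic br LW(1) w(1) LW(2)] by blast
  next
    fix u x y z L w
    assume "diamond_broom n E u x y z L {w}"
    then show ?thesis using diamond_broom_iso[OF n] nB3 by blast
  qed
qed

theorem theorem5p1:
  fixes f :: "real \<Rightarrow> real \<Rightarrow> real" and n :: nat and E :: "nat set set"
  assumes "property_P_star f"
    and "n \<ge> 6"
    and "bicyclic n E"
    and "\<not> graph_iso n E (B1 n)" and "\<not> graph_iso n E (B2 n)"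
    and "\<not> graph_iso n E (B3 n)" and "\<not> graph_iso n E (B4 n)"
  shows "rho (A_f f n E) < rho (A_f f n (B3 n))"
proof -
  let ?A = "{G. admissible n G}"
  have adm: "admissible n E"
    using full_vertex_iso[OF assms(3,2)] B4_shape_iso[OF assms(2)] assms(3,4,5,7)
    unfolding admissible_def by blast
  \<comment> \<open>This single improvement supplies strictness, so the finite maximum below needs
    only weak inequalities.\<close>
  obtain E1 where E1: "admissible n E1" "rho (A_f f n E) < rho (A_f f n E1)"
    using admissible_improve[OF assms(1,2) adm assms(6)] by blast
  have "?A \<subseteq> Pow (Pow {..<n})"
    using simple_subset_Pow bicyclicD(1) unfolding admissible_def by blast
  then have "finite ?A" by (rule finite_subset) simp
  moreover have "?A \<noteq> {}" using adm by blast
  ultimately obtain G where G: "admissible n G"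
    and max: "\<forall>G'\<in>?A. rho (A_f f n G') \<le> rho (A_f f n G)"
    using finite_max_ex[of ?A "\<lambda>G. rho (A_f f n G)"] by blast
  have "graph_iso n G (B3 n)"
    using admissible_improve[OF assms(1,2) G] max by fastforce
  moreover have "simple_graph n G" using G bicyclicD(1) by (auto simp: admissible_def)
  ultimately have "rho (A_f f n G) \<le> rho (A_f f n (B3 n))"
    using iso_rho_le[OF assms(1)] B3_props(1)[OF assms(2)] assms(2) by auto
  moreover have "rho (A_f f n E1) \<le> rho (A_f f n G)" using max E1(1) by blast
  ultimately show ?thesis using E1(2) by linarith
qed

end
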